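(* Let $\mathbb{K}$ be a field of characteristic $0$, $D$ the $n$-th Weyl algebra over $\mathbb{K}$, $I\subset D$ a holonomic left ideal, $0\neq w\in\mathbb{R}^n_{\ge 0}$ a weight vector (with the $w_i$ regarded as elements of $\mathbb{K}$), $s:=\sum_{i=1}^n w_ix_i\partial_i$, and let $q(s)\in\mathbb{K}[s]$. Then $$\big(\operatorname{gr}^V(I)+\operatorname{gr}^V(D)\langle q(s)\rangle\big)\cap\mathbb{K}[s]=\operatorname{gr}^V(I)\cap\mathbb{K}[s]+\mathbb{K}[s]\langle q(s)\rangle.$$
   Context: $D$ is generated over $\mathbb{K}$ by $x_1,\dots,x_n,\partial_1,\dots,\partial_n$ with relations $\partial_i x_j=x_j\partial_i+\delta_{ij}$, $x_jx_i=x_ix_j$, $\partial_j\partial_i=\partial_i\partial_j$. The $V$-filtration on $D$ with respect to $w$ is $\{V_m\mid m\in\mathbb{Z}\}$, where $V_m$ is the $\mathbb{K}$-span of $\{x^\alpha\partial^\beta\mid -w\alpha+w\beta\le m\}$ (so $x_i$ has weight $-w_i$ and $\partial_i$ has weight $w_i$; here $w\alpha=\sum_i w_i\alpha_i$). The associated graded ring $\operatorname{gr}^V(D)=\bigoplus_m V_m/V_{m-1}$ is isomorphic to $D$ and is identified with $D$. For non-zero $P=\sum_{\alpha,\beta\in\mathbb{N}^n}a_{\alpha\beta}x^\alpha\partial^\beta\in D$, put $\operatorname{ord}^V(P)=\max\{-w\alpha+w\beta\mid a_{\alpha\beta}\neq 0\}$, and let the principal symbol be $\sigma^V(P)=\sum_{-w\alpha+w\beta=\operatorname{ord}^V(P)}a_{\alpha\beta}x^\alpha\partial^\beta$.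 For a left ideal $I\subseteq D$, the associated graded ideal is the vector space $\operatorname{gr}^V(I)=\mathbb{K}\cdot\{\sigma^V(P)\mid P\in I\}$, a left ideal of $\operatorname{gr}^V(D)=D$. $\mathbb{K}[s]$ is the subalgebra of $D$ generated by $s=\sum_i w_ix_i\partial_i$ (not central in general), and $\operatorname{gr}^V(D)\langle q(s)\rangle$ is the left ideal generated by $q(s)$. For a holonomic ideal $I$ it is known that $\operatorname{gr}^V(I)\cap\mathbb{K}[s]\neq 0$. *)

theory Defs
  imports "HOL-Analysis.Analysis" "HOL-Computational_Algebra.Polynomial"
begin

section \<open>The Weyl algebra\<close>

text \<open>
  An element of the Weyl algebra in the variables indexed by \<open>'n\<close> is represented by the
  finitely supported family of its coefficients \<open>a\<^sub>\<alpha>\<^sub>\<beta>\<close> with respect to the basis of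
  normally ordered monomials \<open>x\<^sup>\<alpha> \<partial>\<^sup>\<beta>\<close>, indexed by pairs \<open>(\<alpha>, \<beta>)\<close>.
  Lemmas \<open>weyl_relations\<close> and \<open>weyl_gen_induct\<close> show that the resulting ring satisfies the
  defining relations and is generated by the \<open>x\<^sub>i\<close> and \<open>\<partial>\<^sub>i\<close>; as the normally ordered
  monomials are linearly independent in it and span the algebra presented by these relations,
  it is that algebra.
\<close>

typedef (overloaded) ('n, 'k) weyl =
  "{f :: (nat ^ 'n::finite) \<times> (nat ^ 'n) \<Rightarrow> 'k::zero. finite {m. f m \<noteq> 0}}"
  morphisms wcoeff Abs_weyl
  by (rule exI[of _ "\<lambda>_. 0"]) simp

setup_lifting type_definition_weyl

definition wsupp :: "('n::finite, 'k::zero) weyl \<Rightarrow> ((nat ^ 'n) \<times> (nat ^ 'n)) set"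
  where "wsupp P = {m. wcoeff P m \<noteq> 0}"

lemma finite_wsupp [simp]: "finite (wsupp P)"
  using wcoeff[of P] by (simp add: wsupp_def)

lemma weyl_eqI:
  assumes "\<And>m. wcoeff P m = wcoeff Q m"
  shows "P = Q"
proof -
  have "wcoeff P = wcoeff Q" using assms by (rule ext)
  then show ?thesis by (simp add: wcoeff_inject)
qed

instantiation weyl :: (finite, ab_group_add) ab_group_add
begin

lift_definition zero_weyl :: "('a, 'b) weyl" is "\<lambda>_. 0" by simp

lift_definition plus_weyl :: "('a, 'b) weyl \<Rightarrow> ('a, 'b) weyl \<Rightarrow> ('a, 'b) weyl"
  is "\<lambda>f g m. f m + g m"
proof -
  fix f g :: "(nat ^ 'a) \<times> (nat ^ 'a) \<Rightarrow> 'b" assume "finite {m. f m \<noteq> 0}" "finite {m. g m \<noteq> 0}"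
  then have "finite ({m. f m \<noteq> 0} \<union> {m. g m \<noteq> 0})" by simp
  then show "finite {m. f m + g m \<noteq> 0}" by (rule rev_finite_subset) auto
qed

lift_definition uminus_weyl :: "('a, 'b) weyl \<Rightarrow> ('a, 'b) weyl"
  is "\<lambda>f m. - f m" by simp

lift_definition minus_weyl :: "('a, 'b) weyl \<Rightarrow> ('a, 'b) weyl \<Rightarrow> ('a, 'b) weyl"
  is "\<lambda>f g m. f m - g m"
proof -
  fix f g :: "(nat ^ 'a) \<times> (nat ^ 'a) \<Rightarrow> 'b" assume "finite {m. f m \<noteq> 0}" "finite {m. g m \<noteq> 0}"
  then have "finite ({m. f m \<noteq> 0} \<union> {m. g m \<noteq> 0})" by simp
  then show "finite {m. f m - g m \<noteq> 0}" by (rule rev_finite_subset) auto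
qed

instance
proof
  fix P Q R :: "('a, 'b) weyl"
  show "P + Q + R = P + (Q + R)" by transfer (simp add: add.assoc)
  show "P + Q = Q + P" by transfer (simp add: add.commute)
  show "0 + P = P" by transfer simp
  show "- P + P = 0" by transfer simp
  show "P - Q = P + - Q" by transfer simp
qed

end

lift_definition wscale :: "'k::comm_ring_1 \<Rightarrow> ('n::finite, 'k) weyl \<Rightarrow> ('n, 'k) weyl"
  is "\<lambda>c f m. c * f m"
  by (rule finite_subset[of _ "{m. _ m \<noteq> 0}"]) auto

lift_definition wmono :: "nat ^ 'n::finite \<Rightarrow> nat ^ 'n \<Rightarrow> ('n, 'k::comm_ring_1) weyl"
  is "\<lambda>\<alpha> \<beta> m. if m = (\<alpha>, \<beta>) then 1 else 0"
  by simp

text \<open>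
  The relations \<open>\<partial>\<^sub>i x\<^sub>j = x\<^sub>j \<partial>\<^sub>i + \<delta>\<^sub>i\<^sub>j\<close> force, by the Leibniz rule,
  \<open>\<partial>\<^sup>\<beta> x\<^sup>\<gamma> = \<Sum>\<^sub>\<nu> (\<Prod>\<^sub>i \<nu>\<^sub>i! (\<beta>\<^sub>i choose \<nu>\<^sub>i) (\<gamma>\<^sub>i choose \<nu>\<^sub>i)) x\<^sup>\<gamma>\<^sup>-\<^sup>\<nu> \<partial>\<^sup>\<beta>\<^sup>-\<^sup>\<nu>\<close>,
  where the terms with \<open>\<nu> \<le> \<gamma>\<close> violated vanish (so truncated subtraction is harmless).
\<close>

definition leibniz :: "nat ^ 'n::finite \<Rightarrow> nat ^ 'n \<Rightarrow> nat ^ 'n \<Rightarrow> 'k::comm_ring_1"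
  where "leibniz \<beta> \<gamma> \<nu> =
    (\<Prod>i\<in>UNIV. of_nat (fact (\<nu> $ i) * (\<beta> $ i choose \<nu> $ i) * (\<gamma> $ i choose \<nu> $ i)))"

definition mono_times ::
    "(nat ^ 'n::finite) \<times> (nat ^ 'n) \<Rightarrow> (nat ^ 'n) \<times> (nat ^ 'n) \<Rightarrow> ('n, 'k::comm_ring_1) weyl"
  where "mono_times = (\<lambda>(\<alpha>, \<beta>) (\<gamma>, \<delta>).
    \<Sum>\<nu>\<le>\<beta>. wscale (leibniz \<beta> \<gamma> \<nu>) (wmono (\<alpha> + (\<gamma> - \<nu>)) ((\<beta> - \<nu>) + \<delta>)))"

lemma wcoeff_0 [simp]: "wcoeff 0 m = 0"
  by transfer simp

lemma wcoeff_add [simp]: "wcoeff (P + Q) m = wcoeff P m + wcoeff Q m"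
  for P Q :: "('n::finite, 'k::ab_group_add) weyl"
  by transfer simp

lemma wcoeff_scale [simp]: "wcoeff (wscale c P) m = c * wcoeff P m"
  by transfer simp

lemma wcoeff_mono: "wcoeff (wmono \<alpha> \<beta>) m = (if m = (\<alpha>, \<beta>) then 1 else 0)"
  by transfer simp

lemma wcoeff_sum: "wcoeff (\<Sum>x\<in>A. f x) m = (\<Sum>x\<in>A. wcoeff (f x) m)"
  for f :: "'a \<Rightarrow> ('n::finite, 'k::ab_group_add) weyl"
  by (induction A rule: infinite_finite_induct) auto

global_interpretation wmod: module "wscale :: 'k::comm_ring_1 \<Rightarrow> ('n::finite, 'k) weyl \<Rightarrow> _"
  by standard (auto intro!: weyl_eqI simp: algebra_simps)

lemma weyl_expand: "P = (\<Sum>m\<in>wsupp P. wscale (wcoeff P m) (wmono (fst m) (snd m)))"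
proof (rule weyl_eqI)
  fix m
  have "(\<Sum>x\<in>wsupp P. wcoeff P x * (if m = x then 1 else 0)) = wcoeff P m"
    by (simp add: if_distrib[of "\<lambda>t. _ * t"] sum.delta' cong: if_cong)
      (simp add: wsupp_def)
  then show "wcoeff P m = wcoeff (\<Sum>m\<in>wsupp P. wscale (wcoeff P m) (wmono (fst m) (snd m))) m"
    by (simp add: wcoeff_sum wcoeff_mono)
qed

lemma weyl_add_induct [case_names zero add mono]:
  fixes P :: "('n::finite, 'k::comm_ring_1) weyl"
  assumes "T 0" "\<And>P Q. T P \<Longrightarrow> T Q \<Longrightarrow> T (P + Q)" "\<And>c \<alpha> \<beta>. T (wscale c (wmono \<alpha> \<beta>))"
  shows "T P"
proof -
  have "T (\<Sum>m\<in>A. wscale (c m) (wmono (fst m) (snd m)))" for A c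
    by (induction A rule: infinite_finite_induct) (auto intro: assms)
  then show ?thesis
    by (subst weyl_expand)
qed

instantiation weyl :: (finite, comm_ring_1) "{times, one}"
begin

definition one_weyl :: "('a, 'b) weyl" where "one_weyl = wmono 0 0"

definition times_weyl :: "('a, 'b) weyl \<Rightarrow> ('a, 'b) weyl \<Rightarrow> ('a, 'b) weyl"
  where "P * Q =
    (\<Sum>m\<in>wsupp P. \<Sum>m'\<in>wsupp Q. wscale (wcoeff P m * wcoeff Q m') (mono_times m m'))"

instance ..

end

definition wX :: "'n::finite \<Rightarrow> ('n, 'k::comm_ring_1) weyl"
  where "wX i = wmono (axis i 1) 0"

definition wD :: "'n::finite \<Rightarrow> ('n, 'k::comm_ring_1) weyl"
  where "wD i = wmono 0 (axis i 1)"

subsection \<open>Ring structure\<close>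

lemma times_weyl_superset:
  assumes "finite A" "finite B" "wsupp P \<subseteq> A" "wsupp Q \<subseteq> B"
  shows "P * Q = (\<Sum>m\<in>A. \<Sum>m'\<in>B. wscale (wcoeff P m * wcoeff Q m') (mono_times m m'))"
proof -
  have "P * Q = (\<Sum>m\<in>wsupp P. \<Sum>m'\<in>B. wscale (wcoeff P m * wcoeff Q m') (mono_times m m'))"
    unfolding times_weyl_def
    by (intro sum.cong refl sum.mono_neutral_left) (use assms in \<open>auto simp: wsupp_def\<close>)
  also have "\<dots> = (\<Sum>m\<in>A. \<Sum>m'\<in>B. wscale (wcoeff P m * wcoeff Q m') (mono_times m m'))"
    by (intro sum.mono_neutral_left) (use assms in \<open>auto simp: wsupp_def\<close>)
  finally show ?thesis .
qed

lemma weyl_distrib_right: "(P + Q) * R = P * R + Q * (R :: ('n::finite, 'k::comm_ring_1) weyl)"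
proof -
  let ?A = "wsupp P \<union> wsupp Q" and ?B = "wsupp R"
  have *: "wsupp (P + Q) \<subseteq> ?A" by (auto simp: wsupp_def)
  show ?thesis
    by (subst (1 2 3) times_weyl_superset[of ?A ?B])
      (use * in \<open>auto simp: algebra_simps sum.distrib wmod.scale_left_distrib\<close>)
qed

lemma weyl_distrib_left: "R * (P + Q) = R * P + R * (Q :: ('n::finite, 'k::comm_ring_1) weyl)"
proof -
  let ?A = "wsupp P \<union> wsupp Q" and ?B = "wsupp R"
  have *: "wsupp (P + Q) \<subseteq> ?A" by (auto simp: wsupp_def)
  show ?thesis
    by (subst (1 2 3) times_weyl_superset[of ?B ?A])
      (use * in \<open>auto simp: algebra_simps sum.distrib wmod.scale_left_distrib\<close>)
qed

lemma weyl_zero_left: "0 * (R :: ('n::finite, 'k::comm_ring_1) weyl) = 0"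
  by (simp add: times_weyl_def wsupp_def)

lemma weyl_zero_right: "(R :: ('n::finite, 'k::comm_ring_1) weyl) * 0 = 0"
  by (simp add: times_weyl_def wsupp_def)

lemma wscale_times_left: "wscale c P * Q = wscale c (P * Q)"
proof -
  have *: "wsupp (wscale c P) \<subseteq> wsupp P" by (auto simp: wsupp_def)
  show ?thesis
    by (subst (1 2) times_weyl_superset[of "wsupp P" "wsupp Q"])
      (use * in \<open>auto simp: wmod.scale_sum_right mult_ac\<close>)
qed

lemma wscale_times_right: "P * wscale c Q = wscale c (P * Q)"
proof -
  have *: "wsupp (wscale c Q) \<subseteq> wsupp Q" by (auto simp: wsupp_def)
  show ?thesis
    by (subst (1 2) times_weyl_superset[of "wsupp P" "wsupp Q"])
      (use * in \<open>auto simp: wmod.scale_sum_right mult_ac\<close>)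
qed

lemma weyl_sum_right: "R * (\<Sum>x\<in>A. f x) = (\<Sum>x\<in>A. R * f x)"
  for R :: "('n::finite, 'k::comm_ring_1) weyl"
  by (induction A rule: infinite_finite_induct) (auto simp: weyl_distrib_left weyl_zero_right)

lemma wmono_times_wmono:
  "wmono \<alpha> \<beta> * wmono \<gamma> \<delta> = (\<Sum>\<nu>\<le>\<beta>. wscale (leibniz \<beta> \<gamma> \<nu>) (wmono (\<alpha> + (\<gamma> - \<nu>)) ((\<beta> - \<nu>) + \<delta>)))"
  by (subst times_weyl_superset[of "{(\<alpha>, \<beta>)}" "{(\<gamma>, \<delta>)}"])
    (auto simp: wsupp_def wcoeff_mono mono_times_def split: if_splits)

lemma finite_atMost_vec: "finite {..\<beta> :: nat ^ 'n::finite}"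
proof (rule finite_subset)
  show "{..\<beta>} \<subseteq> vec_lambda ` (\<Pi>\<^sub>E i\<in>UNIV. {..\<beta> $ i})"
  proof
    fix \<nu> assume "\<nu> \<in> {..\<beta>}"
    then have "vec_nth \<nu> \<in> (\<Pi>\<^sub>E i\<in>UNIV. {..\<beta> $ i})"
      by (auto simp: less_eq_vec_def)
    then show "\<nu> \<in> vec_lambda ` (\<Pi>\<^sub>E i\<in>UNIV. {..\<beta> $ i})"
      by (metis image_eqI vec_nth_inverse)
  qed
  show "finite (vec_lambda ` (\<Pi>\<^sub>E i\<in>UNIV. {..\<beta> $ i}))"
    by (intro finite_imageI finite_PiE) auto
qed

lemma leibniz_0 [simp]: "leibniz \<beta> \<gamma> 0 = 1"
  by (simp add: leibniz_def)

lemma leibniz_eq_0: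
  assumes "\<not> \<nu> \<le> \<beta>"
  shows "leibniz \<beta> \<gamma> \<nu> = 0"
proof -
  obtain i where "\<beta> $ i < \<nu> $ i"
    using assms by (auto simp: less_eq_vec_def not_le)
  then show ?thesis
    unfolding leibniz_def by (intro prod_zero) (auto simp: binomial_eq_0 intro!: exI[of _ i])
qed

lemma leibniz_eq_0':
  assumes "\<not> \<nu> \<le> \<gamma>"
  shows "leibniz \<beta> \<gamma> \<nu> = 0"
proof -
  obtain i where "\<gamma> $ i < \<nu> $ i"
    using assms by (auto simp: less_eq_vec_def not_le)
  then show ?thesis
    unfolding leibniz_def by (intro prod_zero) (auto simp: binomial_eq_0 intro!: exI[of _ i])
qed

lemma atMost_0_vec: "{..0 :: nat ^ 'n::finite} = {0}"
  by (auto simp: less_eq_vec_def vec_eq_iff)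

lemma atMost_axis: "{..axis i (1::nat)} = {0, axis i 1}"
proof (intro equalityI subsetI)
  fix \<nu> :: "nat ^ 'a" assume *: "\<nu> \<in> {..axis i 1}"
  then have "\<nu> $ j = 0" if "j \<noteq> i" for j
    using that by (auto simp: less_eq_vec_def axis_def dest: spec[of _ j])
  moreover have "\<nu> $ i \<le> 1"
    using * by (auto simp: less_eq_vec_def axis_def dest: spec[of _ i])
  then have "\<nu> $ i = 0 \<or> \<nu> $ i = 1" by auto
  ultimately show "\<nu> \<in> {0, axis i 1}"
    by (auto simp: vec_eq_iff axis_def) metis+
qed (auto simp: less_eq_vec_def axis_def)

lemma wX_times_wmono: "wX i * wmono \<gamma> \<delta> = wmono (axis i 1 + \<gamma>) \<delta>"
  by (simp add: wX_def wmono_times_wmono atMost_0_vec)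

lemma leibniz_axis: "leibniz (axis i 1) \<gamma> (axis i 1) = of_nat (\<gamma> $ i)"
proof -
  have "leibniz (axis i 1) \<gamma> (axis i 1) = (\<Prod>j\<in>UNIV. if j = i then of_nat (\<gamma> $ j) else 1)"
    unfolding leibniz_def by (intro prod.cong) (auto simp: axis_def)
  then show ?thesis by simp
qed

lemma wD_times_wmono:
  "wD i * wmono \<gamma> \<delta> =
    wmono \<gamma> (axis i 1 + \<delta>) + wscale (of_nat (\<gamma> $ i)) (wmono (\<gamma> - axis i 1) \<delta>)"
proof -
  have "(0 :: nat ^ 'a) \<noteq> axis i 1" by (metis axis_eq_0_iff zero_neq_one)
  then show ?thesis
    by (simp add: wD_def wmono_times_wmono atMost_axis leibniz_axis del: One_nat_def)
qed

lemma leibniz_axis_add: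
  "(leibniz (\<beta> + axis i 1) \<gamma> \<nu> :: 'k::comm_ring_1) = leibniz \<beta> \<gamma> \<nu> +
    (if \<nu> $ i = 0 then 0
     else leibniz \<beta> \<gamma> (\<nu> - axis i 1) * of_nat (\<gamma> $ i - (\<nu> $ i - 1)))"
proof -
  define R :: 'k where
    "R = (\<Prod>j\<in>UNIV - {i}. of_nat (fact (\<nu> $ j) * (\<beta> $ j choose \<nu> $ j) * (\<gamma> $ j choose \<nu> $ j)))"
  have L: "leibniz \<beta>' \<gamma> \<nu>' =
      of_nat (fact (\<nu>' $ i) * (\<beta>' $ i choose \<nu>' $ i) * (\<gamma> $ i choose \<nu>' $ i)) * R"
    if "\<And>j. j \<noteq> i \<Longrightarrow> \<beta>' $ j = \<beta> $ j" "\<And>j. j \<noteq> i \<Longrightarrow> \<nu>' $ j = \<nu> $ j" for \<beta>' \<nu>'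
    unfolding leibniz_def R_def
    by (subst prod.remove[of _ i]) (auto simp: that intro!: arg_cong2[of _ _ _ _ "(*)"] prod.cong)
  have 1: "leibniz (\<beta> + axis i 1) \<gamma> \<nu> =
      of_nat (fact (\<nu> $ i) * (Suc (\<beta> $ i) choose \<nu> $ i) * (\<gamma> $ i choose \<nu> $ i)) * R"
    by (subst L) (auto simp: axis_def)
  have 2: "leibniz \<beta> \<gamma> (\<nu> - axis i 1) = of_nat (fact (\<nu> $ i - 1) *
      (\<beta> $ i choose (\<nu> $ i - 1)) * (\<gamma> $ i choose (\<nu> $ i - 1))) * R"
    by (subst L) (auto simp: axis_def)
  have 3: "leibniz \<beta> \<gamma> \<nu> =
      of_nat (fact (\<nu> $ i) * (\<beta> $ i choose \<nu> $ i) * (\<gamma> $ i choose \<nu> $ i)) * R"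
    by (subst L) auto
  show ?thesis
  proof (cases "\<nu> $ i")
    case 0
    then show ?thesis by (simp add: 1 3 del: One_nat_def)
  next
    case (Suc v)
    let ?b = "\<beta> $ i" and ?g = "\<gamma> $ i"
    have a: "Suc v * (?g choose Suc v) = (?g - v) * (?g choose v)"
      by (simp only: binomial_absorption binomial_absorb_comp)
    have "fact (Suc v) * (Suc ?b choose Suc v) * (?g choose Suc v) =
        fact (Suc v) * (?b choose Suc v) * (?g choose Suc v) +
        fact v * (?b choose v) * (Suc v * (?g choose Suc v))"
      by (simp add: algebra_simps)
    also have "\<dots> = fact (Suc v) * (?b choose Suc v) * (?g choose Suc v) +
        fact v * (?b choose v) * (?g choose v) * (?g - v)"
      by (subst a) (simp add: mult_ac)
    finally have "of_nat (fact (Suc v) * (Suc ?b choose Suc v) * (?g choose Suc v)) * R =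
        (of_nat (fact (Suc v) * (?b choose Suc v) * (?g choose Suc v)) +
        of_nat (fact v * (?b choose v) * (?g choose v)) * of_nat (?g - v)) * R"
      by (metis of_nat_add of_nat_mult)
    then show ?thesis
      unfolding 1 2 3 using Suc by (simp add: algebra_simps)
  qed
qed

lemma wX_assoc_mono: "wX i * (wmono \<alpha> \<beta> * wmono \<gamma> \<delta>) = (wX i * wmono \<alpha> \<beta>) * wmono \<gamma> \<delta>"
  unfolding wX_times_wmono
  by (simp add: wmono_times_wmono weyl_sum_right wscale_times_right wX_times_wmono add.assoc)

lemma wD_assoc_mono:
  "wD i * (wmono \<alpha> \<beta> * wmono \<gamma> \<delta>) = (wD i * wmono \<alpha> \<beta>) * (wmono \<gamma> \<delta> :: ('n::finite, 'k::comm_ring_1) weyl)"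
proof -
  let ?e = "axis i 1 :: nat ^ 'n"
  let ?l = "leibniz \<beta> \<gamma> :: _ \<Rightarrow> 'k"
  let ?m = "\<lambda>a b. wmono a b :: ('n, 'k) weyl"
  have eq2: "wscale (of_nat ((\<alpha> + (\<gamma> - \<nu>)) $ i)) (?m (\<alpha> + (\<gamma> - \<nu>) - ?e) d) =
      wscale (of_nat (\<alpha> $ i)) (?m (\<alpha> - ?e + (\<gamma> - \<nu>)) d) +
      wscale (of_nat (\<gamma> $ i - \<nu> $ i)) (?m (\<alpha> + (\<gamma> - (\<nu> + ?e))) d)" for \<nu> d
  proof -
    have "wscale (of_nat (\<alpha> $ i)) (?m (\<alpha> - ?e + (\<gamma> - \<nu>)) d) =
        wscale (of_nat (\<alpha> $ i)) (?m (\<alpha> + (\<gamma> - \<nu>) - ?e) d)"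
    proof (cases "\<alpha> $ i = 0")
      case False
      then have "\<alpha> - ?e + (\<gamma> - \<nu>) = \<alpha> + (\<gamma> - \<nu>) - ?e" by (auto simp: vec_eq_iff axis_def)
      then show ?thesis by simp
    qed simp
    moreover have "wscale (of_nat (\<gamma> $ i - \<nu> $ i)) (?m (\<alpha> + (\<gamma> - (\<nu> + ?e))) d) =
        wscale (of_nat (\<gamma> $ i - \<nu> $ i)) (?m (\<alpha> + (\<gamma> - \<nu>) - ?e) d)"
    proof (cases "\<gamma> $ i - \<nu> $ i = 0")
      case False
      then have "\<alpha> + (\<gamma> - (\<nu> + ?e)) = \<alpha> + (\<gamma> - \<nu>) - ?e" by (auto simp: vec_eq_iff axis_def)
      then show ?thesis by simp
    qed simp
    ultimately show ?thesis
      by (simp add: wmod.scale_left_distrib)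
  qed
  have le: "{..\<beta>} \<subseteq> {..\<beta> + ?e}" by (auto simp: less_eq_vec_def intro: trans_le_add1)
  have A: "?m \<alpha> (?e + \<beta>) * ?m \<gamma> \<delta> =
     (\<Sum>\<nu>\<le>\<beta>. wscale (?l \<nu>) (?m (\<alpha> + (\<gamma> - \<nu>)) (?e + ((\<beta> - \<nu>) + \<delta>)))) +
     (\<Sum>\<nu>\<le>\<beta>. wscale (?l \<nu> * of_nat (\<gamma> $ i - \<nu> $ i)) (?m (\<alpha> + (\<gamma> - (\<nu> + ?e))) ((\<beta> - \<nu>) + \<delta>)))"
  proof -
    let ?t = "\<lambda>\<nu>. ?m (\<alpha> + (\<gamma> - \<nu>)) ((\<beta> + ?e - \<nu>) + \<delta>)"
    have "?m \<alpha> (?e + \<beta>) * ?m \<gamma> \<delta> = (\<Sum>\<nu>\<le>\<beta> + ?e. wscale (leibniz (\<beta> + ?e) \<gamma> \<nu>) (?t \<nu>))"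
      by (simp only: wmono_times_wmono add.commute[of ?e \<beta>])
    also have "\<dots> = (\<Sum>\<nu>\<le>\<beta> + ?e. wscale (?l \<nu>) (?t \<nu>)) +
       (\<Sum>\<nu>\<le>\<beta> + ?e. wscale (if \<nu> $ i = 0 then 0
          else ?l (\<nu> - ?e) * of_nat (\<gamma> $ i - (\<nu> $ i - 1))) (?t \<nu>))"
      by (simp only: leibniz_axis_add wmod.scale_left_distrib sum.distrib)
    also have "(\<Sum>\<nu>\<le>\<beta> + ?e. wscale (?l \<nu>) (?t \<nu>)) = (\<Sum>\<nu>\<le>\<beta>. wscale (?l \<nu>) (?t \<nu>))"
      by (intro sum.mono_neutral_right le finite_atMost_vec) (auto simp: leibniz_eq_0)
    also have "\<dots> = (\<Sum>\<nu>\<le>\<beta>. wscale (?l \<nu>) (?m (\<alpha> + (\<gamma> - \<nu>)) (?e + ((\<beta> - \<nu>) + \<delta>))))"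
    proof (intro sum.cong refl)
      fix \<nu> assume "\<nu> \<in> {..\<beta>}"
      then have "\<beta> + ?e - \<nu> + \<delta> = ?e + ((\<beta> - \<nu>) + \<delta>)"
        by (auto simp: vec_eq_iff less_eq_vec_def axis_def Suc_diff_le)
      then show "wscale (?l \<nu>) (?t \<nu>) =
          wscale (?l \<nu>) (?m (\<alpha> + (\<gamma> - \<nu>)) (?e + ((\<beta> - \<nu>) + \<delta>)))" by simp
    qed
    also have "(\<Sum>\<nu>\<le>\<beta> + ?e. wscale (if \<nu> $ i = 0 then 0
          else ?l (\<nu> - ?e) * of_nat (\<gamma> $ i - (\<nu> $ i - 1))) (?t \<nu>)) =
       (\<Sum>\<nu>\<in>(\<lambda>\<nu>. \<nu> + ?e) ` {..\<beta>}. wscale (if \<nu> $ i = 0 then 0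
          else ?l (\<nu> - ?e) * of_nat (\<gamma> $ i - (\<nu> $ i - 1))) (?t \<nu>))"
    proof (intro sum.mono_neutral_right finite_atMost_vec ballI)
      show "(\<lambda>\<nu>. \<nu> + ?e) ` {..\<beta>} \<subseteq> {..\<beta> + ?e}" by (auto simp: less_eq_vec_def)
      fix \<nu> assume \<nu>: "\<nu> \<in> {..\<beta> + ?e} - (\<lambda>\<nu>. \<nu> + ?e) ` {..\<beta>}"
      have "\<nu> $ i = 0"
      proof (rule ccontr)
        assume n0: "\<nu> $ i \<noteq> 0"
        then have "\<nu> = (\<nu> - ?e) + ?e" by (auto simp: vec_eq_iff axis_def)
        moreover have "\<nu> - ?e \<le> \<beta>"
          using \<nu> by (auto simp: less_eq_vec_def le_diff_conv)
        ultimately show False using \<nu> by blast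
      qed
      then show "wscale (if \<nu> $ i = 0 then 0
          else ?l (\<nu> - ?e) * of_nat (\<gamma> $ i - (\<nu> $ i - 1))) (?t \<nu>) = 0" by simp
    qed
    also have "\<dots> = (\<Sum>\<nu>\<le>\<beta>. wscale (?l \<nu> * of_nat (\<gamma> $ i - \<nu> $ i))
        (?m (\<alpha> + (\<gamma> - (\<nu> + ?e))) ((\<beta> - \<nu>) + \<delta>)))"
    proof (subst sum.reindex)
      show "inj_on (\<lambda>\<nu>. \<nu> + ?e) {..\<beta>}" by (auto simp: inj_on_def)
      have "\<beta> + ?e - (\<nu> + ?e) = \<beta> - \<nu>" "\<nu> + ?e - ?e = \<nu>" for \<nu>
        by (auto simp: vec_eq_iff)
      then show "sum ((\<lambda>\<nu>. wscale (if \<nu> $ i = 0 then 0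
          else ?l (\<nu> - ?e) * of_nat (\<gamma> $ i - (\<nu> $ i - 1))) (?t \<nu>)) \<circ> (\<lambda>\<nu>. \<nu> + ?e)) {..\<beta>} =
        (\<Sum>\<nu>\<le>\<beta>. wscale (?l \<nu> * of_nat (\<gamma> $ i - \<nu> $ i))
        (?m (\<alpha> + (\<gamma> - (\<nu> + ?e))) ((\<beta> - \<nu>) + \<delta>)))"
        by simp
    qed
    finally show ?thesis .
  qed
  have B: "wscale (of_nat (\<alpha> $ i)) (?m (\<alpha> - ?e) \<beta>) * ?m \<gamma> \<delta> =
      (\<Sum>\<nu>\<le>\<beta>. wscale (?l \<nu>) (wscale (of_nat (\<alpha> $ i)) (?m (\<alpha> - ?e + (\<gamma> - \<nu>)) ((\<beta> - \<nu>) + \<delta>))))"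
    by (simp add: wscale_times_left wmono_times_wmono wmod.scale_sum_right mult_ac)
  have "wD i * (?m \<alpha> \<beta> * ?m \<gamma> \<delta>) =
      (\<Sum>\<nu>\<le>\<beta>. wscale (?l \<nu>) (?m (\<alpha> + (\<gamma> - \<nu>)) (?e + ((\<beta> - \<nu>) + \<delta>)))) +
      (\<Sum>\<nu>\<le>\<beta>. wscale (?l \<nu>)
        (wscale (of_nat ((\<alpha> + (\<gamma> - \<nu>)) $ i)) (?m (\<alpha> + (\<gamma> - \<nu>) - ?e) ((\<beta> - \<nu>) + \<delta>))))"
    by (simp only: wmono_times_wmono weyl_sum_right wscale_times_right wD_times_wmono
        wmod.scale_right_distrib sum.distrib)
  then show ?thesis
    unfolding wD_times_wmono weyl_distrib_right A B eq2 wmod.scale_right_distrib sum.distrib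
    by (simp add: algebra_simps)
qed

lemma gen_assoc:
  fixes g P Q :: "('n::finite, 'k::comm_ring_1) weyl"
  assumes "\<And>\<alpha> \<beta> \<gamma> \<delta>. g * (wmono \<alpha> \<beta> * wmono \<gamma> \<delta>) = (g * wmono \<alpha> \<beta>) * wmono \<gamma> \<delta>"
  shows "g * (P * Q) = (g * P) * Q"
proof (induction P rule: weyl_add_induct)
  case (mono c \<alpha> \<beta>)
  show ?case
    by (induction Q rule: weyl_add_induct)
      (simp_all add: weyl_zero_left weyl_zero_right weyl_distrib_left weyl_distrib_right
        wscale_times_left wscale_times_right assms)
qed (simp_all add: weyl_zero_left weyl_zero_right weyl_distrib_left weyl_distrib_right)

lemma weyl_one_left: "1 * P = (P :: ('n::finite, 'k::comm_ring_1) weyl)"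
  by (induction P rule: weyl_add_induct)
    (simp_all add: one_weyl_def weyl_zero_right weyl_distrib_left wscale_times_right
      wmono_times_wmono atMost_0_vec)

lemma weyl_one_right: "P * 1 = (P :: ('n::finite, 'k::comm_ring_1) weyl)"
proof (induction P rule: weyl_add_induct)
  case (mono c \<alpha> \<beta>)
  have "(\<Sum>\<nu>\<le>\<beta>. wscale (leibniz \<beta> 0 \<nu>) (wmono (\<alpha> + (0 - \<nu>)) ((\<beta> - \<nu>) + 0) :: ('n, 'k) weyl)) =
      (\<Sum>\<nu>\<in>{0}. wscale (leibniz \<beta> 0 \<nu>) (wmono (\<alpha> + (0 - \<nu>)) ((\<beta> - \<nu>) + 0)))"
  proof (intro sum.mono_neutral_right finite_atMost_vec ballI)
    fix \<nu> assume "\<nu> \<in> {..\<beta>} - {0}"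
    then have "\<not> \<nu> \<le> 0" using atMost_0_vec by blast
    then show "wscale (leibniz \<beta> 0 \<nu>) (wmono (\<alpha> + (0 - \<nu>)) ((\<beta> - \<nu>) + 0) :: ('n, 'k) weyl) = 0"
      by (simp add: leibniz_eq_0')
  qed (auto simp: less_eq_vec_def)
  then show ?case
    by (simp add: one_weyl_def wscale_times_left wmono_times_wmono)
qed (simp_all add: weyl_zero_left weyl_distrib_right)

text \<open>The constants, \<open>x\<^sub>i\<close> and \<open>\<partial>\<^sub>i\<close> generate the Weyl algebra.\<close>

lemma weyl_gen_induct [case_names zero one add scale X D]:
  fixes P :: "('n::finite, 'k::comm_ring_1) weyl"
  assumes "T 0" "T 1" "\<And>P Q. T P \<Longrightarrow> T Q \<Longrightarrow> T (P + Q)" "\<And>c P. T P \<Longrightarrow> T (wscale c P)"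
    and X: "\<And>i P. T P \<Longrightarrow> T (wX i * P)" and D: "\<And>i P. T P \<Longrightarrow> T (wD i * P)"
  shows "T P"
proof -
  have step: "\<exists>i \<beta>'. \<beta> = axis i 1 + \<beta>' \<and> k = (\<Sum>j\<in>UNIV. \<beta>' $ j)"
    if "(\<Sum>j\<in>UNIV. \<beta> $ j) = Suc k" for \<beta> :: "nat ^ 'n" and k
  proof -
    have "\<exists>i. \<beta> $ i \<noteq> 0"
    proof (rule ccontr)
      assume "\<not> (\<exists>i. \<beta> $ i \<noteq> 0)"
      with that show False by simp
    qed
    then obtain i where "\<beta> $ i \<noteq> 0" ..
    then have *: "\<beta> = axis i 1 + (\<beta> - axis i 1)" by (auto simp: vec_eq_iff axis_def)
    from that have "Suc k = (\<Sum>j\<in>UNIV. \<beta> $ j)" ..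
    also have "\<dots> = (\<Sum>j\<in>UNIV. (axis i 1 + (\<beta> - axis i 1)) $ j)"
      by (subst *) (rule refl)
    also have "\<dots> = (\<Sum>j\<in>UNIV. (axis i 1 :: nat ^ 'n) $ j) + (\<Sum>j\<in>UNIV. (\<beta> - axis i 1) $ j)"
      by (simp only: vector_add_component sum.distrib)
    also have "(\<Sum>j\<in>UNIV. (axis i 1 :: nat ^ 'n) $ j) = 1" by (simp add: axis_def)
    finally have "k = (\<Sum>j\<in>UNIV. (\<beta> - axis i 1) $ j)" by simp
    with * show ?thesis by blast
  qed
  have DD: "T (wmono 0 \<beta>)" if "(\<Sum>j\<in>UNIV. \<beta> $ j) = k" for \<beta> k
    using that
  proof (induction k arbitrary: \<beta>)
    case 0
    then have "\<beta> = 0" by (simp add: vec_eq_iff)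
    then show ?case using assms(2) by (simp add: one_weyl_def)
  next
    case (Suc k)
    then obtain i \<beta>' where *: "\<beta> = axis i 1 + \<beta>'" "k = (\<Sum>j\<in>UNIV. \<beta>' $ j)"
      using step by blast
    then have "T (wD i * wmono 0 \<beta>')" using Suc.IH D by blast
    then show ?case by (simp add: wD_times_wmono *)
  qed
  have "T (wmono \<alpha> \<beta>)" if "(\<Sum>j\<in>UNIV. \<alpha> $ j) = k" for \<alpha> \<beta> k
    using that
  proof (induction k arbitrary: \<alpha>)
    case 0
    then have "\<alpha> = 0" by (simp add: vec_eq_iff)
    then show ?case by (simp add: DD)
  next
    case (Suc k)
    then obtain i \<alpha>' where *: "\<alpha> = axis i 1 + \<alpha>'" "k = (\<Sum>j\<in>UNIV. \<alpha>' $ j)"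
      using step by blast
    then have "T (wX i * wmono \<alpha>' \<beta>)" using Suc.IH X by blast
    then show ?case by (simp add: wX_times_wmono *)
  qed
  then have "T (wmono \<alpha> \<beta>)" for \<alpha> \<beta> by blast
  then show ?thesis
    by (induction P rule: weyl_add_induct) (use assms(1,3,4) in auto)
qed

instance weyl :: (finite, comm_ring_1) ring_1
proof
  fix P Q R :: "('a, 'b) weyl"
  show "P * Q * R = P * (Q * R)"
  proof (induction P rule: weyl_gen_induct)
    case (X i P)
    then show ?case by (simp add: gen_assoc[OF wX_assoc_mono, symmetric])
  next
    case (D i P)
    then show ?case by (simp add: gen_assoc[OF wD_assoc_mono, symmetric])
  qed (simp_all add: weyl_zero_left weyl_one_left weyl_distrib_right wscale_times_left)
  show "(0 :: ('a, 'b) weyl) \<noteq> 1"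
  proof
    assume "(0 :: ('a, 'b) weyl) = 1"
    from arg_cong[OF this, of "\<lambda>P. wcoeff P (0, 0)"]
    show False by (simp add: one_weyl_def wcoeff_mono)
  qed
qed (simp_all add: weyl_distrib_left weyl_distrib_right weyl_one_left weyl_one_right)

text \<open>The defining relations, and \<open>wmono \<alpha> \<beta> = x\<^sup>\<alpha> \<partial>\<^sup>\<beta>\<close>.\<close>

lemma weyl_relations:
  "wD i * wX j = wX j * wD i + (if i = j then 1 else 0 :: ('n::finite, 'k::comm_ring_1) weyl)"
  "wX j * wX i = (wX i * wX j :: ('n, 'k) weyl)"
  "wD j * wD i = (wD i * wD j :: ('n, 'k) weyl)"
proof -
  have *: "(axis j 1 :: nat ^ 'n) $ i = (if i = j then 1 else 0)" by (simp add: axis_def)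
  show "wD i * wX j = wX j * wD i + (if i = j then 1 else 0 :: ('n, 'k) weyl)"
    by (subst wX_def, subst wD_times_wmono, subst wD_def, subst wX_times_wmono)
      (simp add: * one_weyl_def del: One_nat_def)
  show "wX j * wX i = (wX i * wX j :: ('n, 'k) weyl)"
    using wX_times_wmono[of j "axis i 1" 0, where 'b = 'k]
      wX_times_wmono[of i "axis j 1" 0, where 'b = 'k]
    by (simp add: add.commute del: One_nat_def flip: wX_def)
  show "wD j * wD i = (wD i * wD j :: ('n, 'k) weyl)"
    using wD_times_wmono[of j 0 "axis i 1", where 'b = 'k]
      wD_times_wmono[of i 0 "axis j 1", where 'b = 'k]
    by (simp add: add.commute del: One_nat_def flip: wD_def)
qed

lemma wmono_0_0: "wmono 0 0 = 1"
  by (simp add: one_weyl_def)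

lemma wmono_X: "wmono (axis i 1 + \<alpha>) \<beta> = wX i * wmono \<alpha> \<beta>"
  by (simp add: wX_times_wmono)

lemma wmono_D: "wmono 0 (axis i 1 + \<beta>) = wD i * wmono 0 \<beta>"
  by (simp add: wD_times_wmono)

global_interpretation wvs: vector_space "wscale :: 'k::field \<Rightarrow> ('n::finite, 'k) weyl \<Rightarrow> _"
  by unfold_locales (auto intro: wmod.scale_left_distrib wmod.scale_right_distrib)

definition left_ideal :: "('n::finite, 'k::comm_ring_1) weyl set \<Rightarrow> bool"
  where "left_ideal I \<longleftrightarrow>
    0 \<in> I \<and> (\<forall>P\<in>I. \<forall>Q\<in>I. P + Q \<in> I) \<and> (\<forall>R. \<forall>P\<in>I. R * P \<in> I)"

section \<open>Holonomic ideals\<close>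

definition bernstein_filtration :: "nat \<Rightarrow> ('n::finite, 'k::field) weyl set"
  where "bernstein_filtration k =
    wmod.span {wmono \<alpha> \<beta> | \<alpha> \<beta>. (\<Sum>i\<in>UNIV. \<alpha> $ i + \<beta> $ i) \<le> k}"

text \<open>
  The filtration of \<open>D/I\<close> induced by the Bernstein filtration \<open>F\<close> has \<open>k\<close>-th piece
  \<open>F\<^sub>k / (F\<^sub>k \<inter> I)\<close>, a quotient of finite-dimensional spaces.
\<close>

definition hilbert_fun :: "('n::finite, 'k::field) weyl set \<Rightarrow> nat \<Rightarrow> nat"
  where "hilbert_fun I k =
    wvs.dim (bernstein_filtration k :: ('n, 'k) weyl set) - wvs.dim (bernstein_filtration k \<inter> I)"

text \<open>
  \<open>D/I\<close> is zero or has (Bernstein) dimension \<open>n\<close>, the degree of its Hilbert polynomial;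
  this is the same as having Gelfand-Kirillov dimension \<open>n\<close>.
\<close>

definition holonomic :: "('n::finite, 'k::field) weyl set \<Rightarrow> bool"
  where "holonomic I \<longleftrightarrow> I = UNIV \<or>
    (\<exists>h :: rat poly. h \<noteq> 0 \<and> degree h = CARD('n) \<and>
      (\<forall>\<^sub>F k in sequentially. of_nat (hilbert_fun I k) = poly h (of_nat k)))"

section \<open>The V-filtration\<close>

definition Vweight :: "real ^ 'n::finite \<Rightarrow> (nat ^ 'n) \<times> (nat ^ 'n) \<Rightarrow> real"
  where "Vweight w = (\<lambda>(\<alpha>, \<beta>).
    - (\<Sum>i\<in>UNIV. w $ i * real (\<alpha> $ i)) + (\<Sum>i\<in>UNIV. w $ i * real (\<beta> $ i)))"

text \<open>\<open>ordV w P\<close> is meaningful only for \<open>P \<noteq> 0\<close>.\<close>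

definition ordV :: "real ^ 'n::finite \<Rightarrow> ('n, 'k::zero) weyl \<Rightarrow> real"
  where "ordV w P = Max (Vweight w ` wsupp P)"

definition sigmaV :: "real ^ 'n::finite \<Rightarrow> ('n, 'k::comm_ring_1) weyl \<Rightarrow> ('n, 'k) weyl"
  where "sigmaV w P =
    (\<Sum>m\<in>{m \<in> wsupp P. Vweight w m = ordV w P}. wscale (wcoeff P m) (wmono (fst m) (snd m)))"

definition grV :: "real ^ 'n::finite \<Rightarrow> ('n, 'k::field) weyl set \<Rightarrow> ('n, 'k) weyl set"
  where "grV w I = wmod.span {sigmaV w P | P. P \<in> I \<and> P \<noteq> 0}"

section \<open>Subalgebras and ideals generated by one element\<close>

definition weyl_poly :: "'k::comm_ring_1 poly \<Rightarrow> ('n::finite, 'k) weyl \<Rightarrow> ('n, 'k) weyl"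
  where "weyl_poly p P = (\<Sum>i\<le>degree p. wscale (coeff p i) (P ^ i))"

definition subalgebra_gen :: "('n::finite, 'k::comm_ring_1) weyl \<Rightarrow> ('n, 'k) weyl set"
  where "subalgebra_gen P = range (\<lambda>p. weyl_poly p P)"

definition left_mults ::
    "('n::finite, 'k::comm_ring_1) weyl set \<Rightarrow> ('n, 'k) weyl \<Rightarrow> ('n, 'k) weyl set"
  where "left_mults A P = {R * P | R. R \<in> A}"

text \<open>
  Real weights become elements of the ground field \<open>'k\<close> through a field embedding of a subfield
  \<open>F\<close> of the reals into \<open>'k\<close>; the values of \<open>\<phi>\<close> outside \<open>F\<close> are irrelevant.
\<close>

definition real_subfield_embedding :: "real set \<Rightarrow> (real \<Rightarrow> 'k::field) \<Rightarrow> bool"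
  where "real_subfield_embedding F \<phi> \<longleftrightarrow>
    1 \<in> F \<and> (\<forall>a\<in>F. \<forall>b\<in>F. a - b \<in> F \<and> a * b \<in> F) \<and> (\<forall>a\<in>F. inverse a \<in> F) \<and>
    \<phi> 1 = 1 \<and> (\<forall>a\<in>F. \<forall>b\<in>F. \<phi> (a + b) = \<phi> a + \<phi> b \<and> \<phi> (a * b) = \<phi> a * \<phi> b)"

definition euler_op :: "(real \<Rightarrow> 'k::comm_ring_1) \<Rightarrow> real ^ 'n::finite \<Rightarrow> ('n, 'k) weyl"
  where "euler_op \<phi> w = (\<Sum>i\<in>UNIV. wscale (\<phi> (w $ i)) (wX i * wD i))"

end

theory Submission
  imports Defs
begin

text \<open>
  Write \<open>J = gr\<^sup>V(I)\<close>. The argument rests on the structure of \<open>J\<close>: it is a left ideal spanned by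
  weight-homogeneous elements (\<open>left_ideal_grV\<close>, \<open>Vpart_grV\<close>), and an element \<open>R\<close> that is
  homogeneous of weight \<open>d\<close> satisfies \<open>R s = s R + \<phi>(d) R\<close> (\<open>Vhom_times_euler_op\<close>). So elements of
  weight 0 commute with \<open>s\<close>, and \<open>J\<close> is stable under right multiplication by \<open>s\<close>.

  Suppose that the ideal \<open>T = {p. p(s) \<in> J}\<close> of \<open>K[X]\<close> is generated by some \<open>b \<noteq> 0\<close>, let \<open>g\<close> be a
  greatest common divisor of \<open>b = g b'\<close> and \<open>q = g q'\<close>, and let \<open>p(s) = j + R q(s)\<close> with \<open>j \<in> J\<close>.
  Taking weight-0 parts, one may assume that \<open>j\<close> and \<open>R\<close> have weight 0. Then \<open>R\<close> commutes with \<open>s\<close>,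
  and \<open>b'(s) p(s) = b'(s) j + R q'(s) b(s) \<in> J\<close>. Hence \<open>b\<close> divides \<open>b' p\<close>, and after cancelling
  \<open>b' \<noteq> 0\<close>, \<open>g\<close> divides \<open>p\<close>. By Bezout, \<open>p\<close> is a combination of \<open>b\<close> and \<open>q\<close>, which is the claim.

  It remains to see that \<open>T \<noteq> 0\<close>, and this is where holonomicity enters. Let \<open>F\<^sub>k\<close> be the Bernstein
  filtration. Symbols of elements of \<open>F\<^sub>k \<inter> I\<close> lie in \<open>F\<^sub>k \<inter> J\<close> and span a space at least as large
  as \<open>F\<^sub>k \<inter> I\<close> (\<open>dim_le_dim_symbols\<close>), so \<open>D/J\<close> grows at most like \<open>D/I\<close>, that is,
  \<open>dim F\<^sub>k/(F\<^sub>k \<inter> J) \<le> C k\<^sup>n\<close> for large \<open>k\<close>. Now regard \<open>D/J\<close> as a module over \<open>D[t]\<close>, where \<open>t\<close> acts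
  as right multiplication by \<open>s\<close>. If \<open>T = 0\<close>, then Bernstein's commutator argument shows that a
  nonzero \<open>\<Sum>\<^sub>j P\<^sub>j t\<^sup>j\<close> with all \<open>P\<^sub>j \<in> F\<^sub>k\<close> does not annihilate the image of \<open>F\<^sub>k\<close>
  (\<open>bernstein_faithful\<close>). For \<open>j \<le> k\<close> these operators form a space of dimension of order
  \<open>k\<^sup>2\<^sup>n\<^sup>+\<^sup>1\<close>, and each maps \<open>F\<^sub>k/(F\<^sub>k \<inter> J)\<close> to \<open>F\<^sub>4\<^sub>k/(F\<^sub>4\<^sub>k \<inter> J)\<close>; but the space of all linear maps
  between these two has dimension of order at most \<open>k\<^sup>2\<^sup>n\<close> (\<open>annihilating_family\<close>), a contradiction.
\<close>


section \<open>Normally ordered products\<close>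

lemma wmono_times_wD: "wmono \<alpha> \<beta> * wD i = wmono \<alpha> (axis i 1 + \<beta>)"
proof -
  have "wmono \<alpha> \<beta> * wD i =
      (\<Sum>\<nu>\<in>{0}. wscale (leibniz \<beta> 0 \<nu>) (wmono (\<alpha> + (0 - \<nu>)) ((\<beta> - \<nu>) + axis i 1)))"
    unfolding wD_def wmono_times_wmono
  proof (intro sum.mono_neutral_right finite_atMost_vec ballI)
    fix \<nu> assume "\<nu> \<in> {..\<beta>} - {0}"
    then have "\<not> \<nu> \<le> 0" using atMost_0_vec by blast
    then show "wscale (leibniz \<beta> 0 \<nu>) (wmono (\<alpha> + (0 - \<nu>)) ((\<beta> - \<nu>) + axis i 1)) = 0"
      by (simp add: leibniz_eq_0')
  qed (auto simp: less_eq_vec_def)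
  then show ?thesis by (simp add: add.commute)
qed

lemma leibniz_axis': "leibniz \<beta> (axis i 1) (axis i 1) = of_nat (\<beta> $ i)"
proof -
  have "leibniz \<beta> (axis i 1) (axis i 1) = (\<Prod>j\<in>UNIV. if j = i then of_nat (\<beta> $ j) else 1)"
    unfolding leibniz_def by (intro prod.cong) (auto simp: axis_def)
  then show ?thesis by simp
qed

lemma wmono_times_wX:
  "wmono \<alpha> \<beta> * wX i =
    wmono (axis i 1 + \<alpha>) \<beta> + wscale (of_nat (\<beta> $ i)) (wmono \<alpha> (\<beta> - axis i 1))"
proof -
  let ?f = "\<lambda>\<nu>. wscale (leibniz \<beta> (axis i 1) \<nu>) (wmono (\<alpha> + (axis i 1 - \<nu>)) ((\<beta> - \<nu>) + 0))"
  have "sum ?f {..\<beta>} = sum ?f {..axis i 1}"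
    by (rule sum.mono_neutral_cong) (auto simp: finite_atMost_vec leibniz_eq_0 leibniz_eq_0')
  moreover have "(0 :: nat ^ 'a) \<noteq> axis i 1" by (metis axis_eq_0_iff zero_neq_one)
  ultimately show ?thesis
    by (simp add: wX_def wmono_times_wmono atMost_axis leibniz_axis' add.commute del: One_nat_def)
qed

text \<open>
  Every product obeys the Leibniz rule monomial by monomial, so all statements about degrees and
  weights of products reduce to this description of the monomials that can occur.
\<close>

lemma wsupp_times:
  assumes "m \<in> wsupp (P * Q)"
  obtains \<alpha> \<beta> \<gamma> \<delta> \<nu> where "(\<alpha>, \<beta>) \<in> wsupp P" "(\<gamma>, \<delta>) \<in> wsupp Q" "\<nu> \<le> \<beta>" "\<nu> \<le> \<gamma>"
    "m = (\<alpha> + (\<gamma> - \<nu>), (\<beta> - \<nu>) + \<delta>)"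
proof -
  have "(\<Sum>p\<in>wsupp P. \<Sum>q\<in>wsupp Q. wcoeff P p * wcoeff Q q * wcoeff (mono_times p q) m) \<noteq> 0"
    using assms[unfolded wsupp_def mem_Collect_eq]
    unfolding times_weyl_def wcoeff_sum wcoeff_scale .
  then obtain p q where p: "p \<in> wsupp P" and q: "q \<in> wsupp Q"
    and "wcoeff P p * wcoeff Q q * wcoeff (mono_times p q) m \<noteq> 0"
    by (meson sum.not_neutral_contains_not_neutral)
  then have c: "wcoeff (mono_times p q :: ('a, 'b) weyl) m \<noteq> 0" by auto
  obtain \<alpha> \<beta> \<gamma> \<delta> where pq: "p = (\<alpha>, \<beta>)" "q = (\<gamma>, \<delta>)" by fastforce
  from c obtain \<nu> where "\<nu> \<le> \<beta>"
    and \<nu>: "(leibniz \<beta> \<gamma> \<nu> :: 'b) * (if m = (\<alpha> + (\<gamma> - \<nu>), (\<beta> - \<nu>) + \<delta>) then 1 else 0) \<noteq> 0"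
    unfolding pq mono_times_def prod.case wcoeff_sum wcoeff_scale wcoeff_mono
    by (meson sum.not_neutral_contains_not_neutral atMost_iff)
  moreover have "\<nu> \<le> \<gamma>" using \<nu> leibniz_eq_0'[of \<nu> \<gamma> \<beta>, where 'b = 'b] by fastforce
  ultimately show thesis using that p q pq by (auto split: if_splits)
qed

lemma wcoeff_diff [simp]: "wcoeff (P - Q) m = wcoeff P m - wcoeff Q m"
  for P Q :: "('n::finite, 'k::ab_group_add) weyl"
  by transfer simp

lemma wsupp_add: "wsupp (P + Q) \<subseteq> wsupp P \<union> wsupp Q" for P :: "('n::finite, 'k::ab_group_add) weyl"
  by (auto simp: wsupp_def)

lemma wsupp_scale: "wsupp (wscale c P) \<subseteq> wsupp P"
  by (auto simp: wsupp_def)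

lemma wsupp_0 [simp]: "wsupp 0 = {}"
  by (simp add: wsupp_def)

lemma wsupp_mono [simp]: "wsupp (wmono \<alpha> \<beta> :: ('n::finite, 'k::comm_ring_1) weyl) = {(\<alpha>, \<beta>)}"
  by (auto simp: wsupp_def wcoeff_mono)

lemma wsupp_eq_empty_iff [simp]: "wsupp P = {} \<longleftrightarrow> P = 0"
  by (auto simp: wsupp_def intro: weyl_eqI)

section \<open>The Bernstein filtration\<close>

lemma bernstein_filtration_iff:
  "P \<in> bernstein_filtration k \<longleftrightarrow> (\<forall>(\<alpha>, \<beta>)\<in>wsupp P. (\<Sum>i\<in>UNIV. \<alpha> $ i + \<beta> $ i) \<le> k)"
  (is "_ \<longleftrightarrow> ?R P")
proof
  assume "P \<in> bernstein_filtration k"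
  then show "?R P"
    unfolding bernstein_filtration_def
  proof (induction rule: wmod.span_induct_alt)
    case (step c x y)
    then obtain \<alpha> \<beta> where x: "x = wmono \<alpha> \<beta>" "(\<Sum>i\<in>UNIV. \<alpha> $ i + \<beta> $ i) \<le> k" by blast
    have "wsupp (wscale c x + y) \<subseteq> insert (\<alpha>, \<beta>) (wsupp y)"
      using wsupp_add[of "wscale c x" y] wsupp_scale[of c x] unfolding x by auto
    then show ?case using x step by fastforce
  qed simp
next
  assume R: "?R P"
  show "P \<in> bernstein_filtration k"
    unfolding bernstein_filtration_def
    by (subst weyl_expand, intro wmod.span_sum wmod.span_scale wmod.span_base)
      (use R in \<open>auto simp: case_prod_unfold\<close>)
qed

lemma subspace_bernstein: "wmod.subspace (bernstein_filtration k)"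
  unfolding bernstein_filtration_def by (rule wmod.subspace_span)

lemma bernstein_times:
  assumes "P \<in> bernstein_filtration a" "Q \<in> bernstein_filtration b"
  shows "P * Q \<in> bernstein_filtration (a + b)"
  unfolding bernstein_filtration_iff
proof safe
  fix \<alpha>' \<beta>' assume "(\<alpha>', \<beta>') \<in> wsupp (P * Q)"
  then obtain \<alpha> \<beta> \<gamma> \<delta> \<nu> where *: "(\<alpha>, \<beta>) \<in> wsupp P" "(\<gamma>, \<delta>) \<in> wsupp Q" "\<nu> \<le> \<beta>" "\<nu> \<le> \<gamma>"
    "\<alpha>' = \<alpha> + (\<gamma> - \<nu>)" "\<beta>' = (\<beta> - \<nu>) + \<delta>"
    by (elim wsupp_times) auto
  have "(\<Sum>i\<in>UNIV. \<alpha>' $ i + \<beta>' $ i) \<le> (\<Sum>i\<in>UNIV. (\<alpha> $ i + \<beta> $ i) + (\<gamma> $ i + \<delta> $ i))"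
    by (intro sum_mono) (simp add: *)
  also have "\<dots> \<le> a + b"
    using assms * unfolding bernstein_filtration_iff sum.distrib by fastforce
  finally show "(\<Sum>i\<in>UNIV. \<alpha>' $ i + \<beta>' $ i) \<le> a + b" .
qed

lemma bernstein_mono: "a \<le> b \<Longrightarrow> bernstein_filtration a \<subseteq> bernstein_filtration b"
  by (fastforce simp: bernstein_filtration_iff)

lemma one_in_bernstein: "1 \<in> bernstein_filtration 0"
  by (simp add: bernstein_filtration_iff one_weyl_def)

lemma bernstein_power:
  assumes "P \<in> bernstein_filtration a"
  shows "P ^ j \<in> bernstein_filtration (j * a)"
  by (induction j) (use assms one_in_bernstein in \<open>auto intro!: bernstein_times\<close>)

lemma finite_bounded_degree: "finite {(\<alpha> :: nat ^ 'n::finite, \<beta> :: nat ^ 'n). (\<Sum>i\<in>UNIV. \<alpha> $ i + \<beta> $ i) \<le> k}"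
proof (rule finite_subset)
  show "{(\<alpha> :: nat ^ 'n, \<beta> :: nat ^ 'n). (\<Sum>i\<in>UNIV. \<alpha> $ i + \<beta> $ i) \<le> k} \<subseteq> {..(\<chi> i. k)} \<times> {..(\<chi> i. k)}"
  proof safe
    fix \<alpha> \<beta> :: "nat ^ 'n" assume k: "(\<Sum>i\<in>UNIV. \<alpha> $ i + \<beta> $ i) \<le> k"
    have "\<alpha> $ i + \<beta> $ i \<le> k" for i
      using member_le_sum[of i UNIV "\<lambda>i. \<alpha> $ i + \<beta> $ i"] k by simp
    then show "\<alpha> \<le> (\<chi> i. k)" "\<beta> \<le> (\<chi> i. k)"
      by (auto simp: less_eq_vec_def intro: add_leD1 add_leD2)
  qed
qed (simp add: finite_atMost_vec)

lemma bernstein_finite_span: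
  "\<exists>B. finite B \<and> (bernstein_filtration k :: ('n::finite, 'k::field) weyl set) = wmod.span B"
proof (intro exI conjI)
  let ?B = "{wmono \<alpha> \<beta> | \<alpha> \<beta>. (\<Sum>i\<in>UNIV. \<alpha> $ i + \<beta> $ i) \<le> k} :: ('n, 'k) weyl set"
  have "?B = (\<lambda>(\<alpha>, \<beta>). wmono \<alpha> \<beta>) ` {(\<alpha>, \<beta>). (\<Sum>i\<in>UNIV. \<alpha> $ i + \<beta> $ i) \<le> k}" by auto
  then show "finite ?B" by (simp only: finite_imageI finite_bounded_degree)
  show "bernstein_filtration k = wmod.span ?B" by (simp add: bernstein_filtration_def)
qed

section \<open>The grading by weights\<close>

text \<open>
  The homogeneous component of weight \<open>d\<close>; \<open>sigmaV\<close> is the component of the highest weight.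
\<close>

definition Vpart :: "real ^ 'n::finite \<Rightarrow> real \<Rightarrow> ('n, 'k::comm_ring_1) weyl \<Rightarrow> ('n, 'k) weyl"
  where "Vpart w d P =
    (\<Sum>m\<in>{m \<in> wsupp P. Vweight w m = d}. wscale (wcoeff P m) (wmono (fst m) (snd m)))"

definition Vhom :: "real ^ 'n::finite \<Rightarrow> real \<Rightarrow> ('n, 'k::zero) weyl \<Rightarrow> bool"
  where "Vhom w d P \<longleftrightarrow> (\<forall>m\<in>wsupp P. Vweight w m = d)"

lemma sigmaV_eq: "sigmaV w P = Vpart w (ordV w P) P"
  by (simp add: sigmaV_def Vpart_def)

lemma wcoeff_Vpart: "wcoeff (Vpart w d P) m = (if Vweight w m = d then wcoeff P m else 0)"
proof -
  have "wcoeff (Vpart w d P) m =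
      (\<Sum>x\<in>{m \<in> wsupp P. Vweight w m = d}. if m = x then wcoeff P x else 0)"
    unfolding Vpart_def wcoeff_sum by (intro sum.cong) (auto simp: wcoeff_mono)
  also have "\<dots> = (if m \<in> {m \<in> wsupp P. Vweight w m = d} then wcoeff P m else 0)"
    by (rule sum.delta') simp
  finally show ?thesis by (auto simp: wsupp_def)
qed

lemma Vpart_add: "Vpart w d (P + Q) = Vpart w d P + Vpart w d Q"
  by (rule weyl_eqI) (simp add: wcoeff_Vpart)

lemma Vpart_diff: "Vpart w d (P - Q) = Vpart w d P - Vpart w d Q"
  by (rule weyl_eqI) (simp add: wcoeff_Vpart)

lemma Vpart_scale: "Vpart w d (wscale c P) = wscale c (Vpart w d P)"
  by (rule weyl_eqI) (simp add: wcoeff_Vpart)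

lemma Vpart_0 [simp]: "Vpart w d 0 = 0"
  by (rule weyl_eqI) (simp add: wcoeff_Vpart)

lemma Vpart_sum: "Vpart w d (\<Sum>x\<in>A. f x) = (\<Sum>x\<in>A. Vpart w d (f x))"
  by (induction A rule: infinite_finite_induct) (auto simp: Vpart_add)

lemma Vhom_Vpart: "Vhom w d (Vpart w d P)"
  by (auto simp: Vhom_def wsupp_def wcoeff_Vpart)

lemma Vpart_Vhom: "Vhom w d P \<Longrightarrow> Vpart w d' P = (if d' = d then P else 0)"
proof (rule weyl_eqI)
  fix m assume "Vhom w d P"
  then have "wcoeff P m = 0" if "Vweight w m \<noteq> d"
    using that unfolding Vhom_def wsupp_def by blast
  then show "wcoeff (Vpart w d' P) m = wcoeff (if d' = d then P else 0) m"
    by (auto simp: wcoeff_Vpart)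
qed

lemma Vhom_wmono: "Vhom w (Vweight w (\<alpha>, \<beta>)) (wmono \<alpha> \<beta> :: ('n::finite, 'k::comm_ring_1) weyl)"
  by (simp add: Vhom_def)

lemma Vhom_scale: "Vhom w d P \<Longrightarrow> Vhom w d (wscale c P)"
  using wsupp_scale[of c P] by (auto simp: Vhom_def)

lemma Vhom_add: "Vhom w d P \<Longrightarrow> Vhom w d Q \<Longrightarrow> Vhom w d (P + Q)"
  for P :: "('n::finite, 'k::comm_ring_1) weyl"
  using wsupp_add[of P Q] by (auto simp: Vhom_def)

lemma Vhom_0 [simp]: "Vhom w d 0"
  by (simp add: Vhom_def)

lemma Vhom_sum: "(\<And>x. x \<in> A \<Longrightarrow> Vhom w d (f x)) \<Longrightarrow> Vhom w d (sum f A)"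
  for f :: "'a \<Rightarrow> ('n::finite, 'k::comm_ring_1) weyl"
  by (induction A rule: infinite_finite_induct) (auto intro: Vhom_add)

text \<open>
  Contracting \<open>\<nu>\<close> derivatives with \<open>\<nu>\<close> variables removes the weights \<open>w\<nu>\<close> and \<open>-w\<nu>\<close>, which cancel.
  This is why the \<open>V\<close>-filtration comes from a grading of the ring.
\<close>

lemma Vweight_contract:
  assumes "\<nu> \<le> \<beta>" "\<nu> \<le> \<gamma>"
  shows "Vweight w (\<alpha> + (\<gamma> - \<nu>), (\<beta> - \<nu>) + \<delta>) = Vweight w (\<alpha>, \<beta>) + Vweight w (\<gamma>, \<delta>)"
proof -
  have "real (\<alpha> $ i + (\<gamma> $ i - \<nu> $ i)) = real (\<alpha> $ i) + real (\<gamma> $ i) - real (\<nu> $ i)"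
    "real ((\<beta> $ i - \<nu> $ i) + \<delta> $ i) = real (\<beta> $ i) + real (\<delta> $ i) - real (\<nu> $ i)" for i
    using spec[OF assms(1)[unfolded less_eq_vec_def], of i]
      spec[OF assms(2)[unfolded less_eq_vec_def], of i] by simp_all
  then show ?thesis
    by (simp only: Vweight_def prod.case vector_add_component vector_minus_component)
      (simp add: algebra_simps sum.distrib sum_subtractf)
qed

lemma Vhom_times:
  assumes "Vhom w d P" "Vhom w e Q"
  shows "Vhom w (d + e) (P * Q)"
  unfolding Vhom_def
proof
  fix m assume "m \<in> wsupp (P * Q)"
  then show "Vweight w m = d + e"
    using assms by (elim wsupp_times) (fastforce simp: Vweight_contract Vhom_def)
qed

lemma Vhom_1: "Vhom w 0 1"
  by (simp add: Vhom_def one_weyl_def Vweight_def)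

lemma Vhom_power: "Vhom w 0 P \<Longrightarrow> Vhom w 0 (P ^ j)"
  using Vhom_times[of w 0 P 0] by (induction j) (auto simp: Vhom_1)

lemma Vpart_times_left:
  assumes "Vhom w e R"
  shows "Vpart w (e + d) (R * P) = R * Vpart w d P"
proof (induction P rule: weyl_add_induct)
  case (mono c \<alpha> \<beta>)
  have h: "Vhom w (Vweight w (\<alpha>, \<beta>)) (wscale c (wmono \<alpha> \<beta>) :: ('a, 'b) weyl)"
    by (intro Vhom_scale Vhom_wmono)
  show ?case
    using Vpart_Vhom[OF h, of d] Vpart_Vhom[OF Vhom_times[OF assms h], of "e + d"]
    by (auto simp: weyl_zero_right)
qed (simp_all add: weyl_zero_right weyl_distrib_left Vpart_add)

lemma Vpart_times_right:
  assumes "Vhom w e R"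
  shows "Vpart w (d + e) (P * R) = Vpart w d P * R"
proof (induction P rule: weyl_add_induct)
  case (mono c \<alpha> \<beta>)
  have h: "Vhom w (Vweight w (\<alpha>, \<beta>)) (wscale c (wmono \<alpha> \<beta>) :: ('a, 'b) weyl)"
    by (intro Vhom_scale Vhom_wmono)
  show ?case
    using Vpart_Vhom[OF h, of d] Vpart_Vhom[OF Vhom_times[OF h assms], of "d + e"]
    by (auto simp: weyl_zero_left)
qed (simp_all add: weyl_zero_left weyl_distrib_right Vpart_add)

lemma Vweight_le_ordV: "m \<in> wsupp P \<Longrightarrow> Vweight w m \<le> ordV w P"
  by (simp add: ordV_def)

lemma ordV_attained:
  assumes "P \<noteq> 0"
  obtains m where "m \<in> wsupp P" "Vweight w m = ordV w P"
proof -
  have "ordV w P \<in> Vweight w ` wsupp P"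
    unfolding ordV_def using assms by (intro Max_in) auto
  then show thesis using that by force
qed

lemma sigmaV_eqI:
  assumes "Vpart w d P \<noteq> 0" "\<And>m. m \<in> wsupp P \<Longrightarrow> Vweight w m \<le> d"
  shows "sigmaV w P = Vpart w d P"
proof -
  obtain m where "m \<in> wsupp (Vpart w d P)" using assms(1) wsupp_eq_empty_iff by blast
  then have m: "m \<in> wsupp P" "Vweight w m = d" by (auto simp: wsupp_def wcoeff_Vpart split: if_splits)
  then have "P \<noteq> 0" by auto
  then have "ordV w P \<le> d" using ordV_attained assms(2) by metis
  moreover have "d \<le> ordV w P" using Vweight_le_ordV[OF m(1)] m(2) by metis
  ultimately show ?thesis by (simp add: sigmaV_eq)
qed

lemma sigmaV_times:
  assumes R: "Vhom w e R" and "R * sigmaV w P \<noteq> 0"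
  shows "sigmaV w (R * P) = R * sigmaV w P"
proof -
  have eq: "Vpart w (e + ordV w P) (R * P) = R * sigmaV w P"
    by (simp add: Vpart_times_left[OF R] sigmaV_eq)
  have "Vweight w m \<le> e + ordV w P" if "m \<in> wsupp (R * P)" for m
    using that
  proof (rule wsupp_times)
    fix \<alpha> \<beta> \<gamma> \<delta> \<nu> assume "(\<alpha>, \<beta>) \<in> wsupp R" "(\<gamma>, \<delta>) \<in> wsupp P" "\<nu> \<le> \<beta>" "\<nu> \<le> \<gamma>"
      "m = (\<alpha> + (\<gamma> - \<nu>), (\<beta> - \<nu>) + \<delta>)"
    then show ?thesis
      using R Vweight_le_ordV[of "(\<gamma>, \<delta>)" P w] by (auto simp: Vweight_contract Vhom_def)
  qed
  then show ?thesis using sigmaV_eqI[of w "e + ordV w P" "R * P"] assms eq by metis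
qed

lemma wscale_eq_times: "wscale c P = wscale c 1 * P"
  by (simp add: wscale_times_left)

lemma left_ideal_subspace:
  assumes "left_ideal I"
  shows "wmod.subspace (I :: ('n::finite, 'k::field) weyl set)"
  unfolding wmod.subspace_def
  using assms wscale_eq_times[where 'a = 'n and 'b = 'k] unfolding left_ideal_def by metis

lemma left_ideal_minus:
  assumes "left_ideal J" "P \<in> J" "Q \<in> J"
  shows "P - Q \<in> J"
proof -
  have "P + (- 1) * Q \<in> J" using assms unfolding left_ideal_def by blast
  then show ?thesis by simp
qed

text \<open>
  For homogeneous \<open>R\<close>, the product \<open>R \<sigma>(P)\<close> is the component of \<open>R P\<close> in the weight where its symbol
  would live: it is \<open>\<sigma>(R P)\<close> or zero. By linearity it suffices to treat monomials \<open>R\<close>.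
\<close>

lemma left_ideal_grV:
  assumes I: "left_ideal I"
  shows "left_ideal (grV w I)"
  unfolding left_ideal_def
proof (intro conjI ballI allI)
  let ?S = "{sigmaV w P | P. P \<in> I \<and> P \<noteq> 0}"
  show "0 \<in> grV w I" by (simp add: grV_def wmod.span_zero)
  show "P + Q \<in> grV w I" if "P \<in> grV w I" "Q \<in> grV w I" for P Q
    using that by (simp add: grV_def wmod.span_add)
  fix R Q assume "Q \<in> grV w I"
  show "R * Q \<in> grV w I"
  proof (induction R rule: weyl_add_induct)
    case (mono c \<alpha> \<beta>)
    define R where "R = (wscale c (wmono \<alpha> \<beta>) :: ('a, 'b) weyl)"
    have R: "Vhom w (Vweight w (\<alpha>, \<beta>)) R" unfolding R_def by (intro Vhom_scale Vhom_wmono)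
    have gen: "R * sigmaV w P \<in> wmod.span ?S" if P: "P \<in> I" "P \<noteq> 0" for P
    proof (cases "R * sigmaV w P = 0")
      case False
      then have "sigmaV w (R * P) = R * sigmaV w P" using sigmaV_times[OF R] by blast
      moreover have "R * P \<noteq> 0"
      proof
        assume "R * P = 0"
        then have "Vpart w (Vweight w (\<alpha>, \<beta>) + ordV w P) (R * P) = 0" by simp
        then show False using False Vpart_times_left[OF R] by (simp add: sigmaV_eq)
      qed
      moreover have "R * P \<in> I" using I P by (auto simp: left_ideal_def)
      ultimately have "R * sigmaV w P \<in> ?S" by force
      then show ?thesis by (rule wmod.span_base)
    qed (simp add: wmod.span_zero)
    from \<open>Q \<in> grV w I\<close> have "R * Q \<in> wmod.span ?S"
      unfolding grV_def
    proof (induction rule: wmod.span_induct_alt)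
      case (step a x y)
      then show ?case using gen
        by (auto simp: weyl_distrib_left wscale_times_right intro: wmod.span_add wmod.span_scale)
    qed (simp add: weyl_zero_right wmod.span_zero)
    then show ?case by (simp add: R_def grV_def)
  qed (simp_all add: weyl_zero_left weyl_distrib_right grV_def wmod.span_zero wmod.span_add)
qed

lemma Vpart_grV:
  assumes "P \<in> grV w I"
  shows "Vpart w d P \<in> grV w I"
  using assms unfolding grV_def
proof (induction rule: wmod.span_induct_alt)
  case (step c x y)
  then have "x \<in> wmod.span {sigmaV w P | P. P \<in> I \<and> P \<noteq> 0}" by (blast intro: wmod.span_base)
  moreover obtain e where "Vhom w e x" using step(1) Vhom_Vpart by (auto simp: sigmaV_eq)
  ultimately show ?case using step
    by (auto simp: Vpart_add Vpart_scale Vpart_Vhom intro: wmod.span_add wmod.span_scale)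
qed (simp add: wmod.span_zero)

section \<open>Polynomials in one element\<close>

lemma weyl_poly_superset:
  assumes "degree p \<le> n"
  shows "weyl_poly p P = (\<Sum>i\<le>n. wscale (coeff p i) (P ^ i))"
  unfolding weyl_poly_def
  by (rule sum.mono_neutral_left) (use assms in \<open>auto simp: coeff_eq_0\<close>)

lemma weyl_poly_add: "weyl_poly (p + q) P = weyl_poly p P + weyl_poly q P"
proof -
  let ?n = "max (degree p) (degree q)"
  show ?thesis
    by (subst (1 2 3) weyl_poly_superset[of _ ?n])
      (auto simp: degree_add_le wmod.scale_left_distrib sum.distrib)
qed

lemma weyl_poly_0 [simp]: "weyl_poly 0 P = 0"
  by (simp add: weyl_poly_def)

lemma weyl_poly_pCons: "weyl_poly (pCons a p) P = wscale a 1 + P * weyl_poly p P"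
proof -
  have "weyl_poly (pCons a p) P = (\<Sum>i\<le>Suc (degree p). wscale (coeff (pCons a p) i) (P ^ i))"
    by (rule weyl_poly_superset) (simp add: degree_pCons_eq_if)
  then show ?thesis
    by (simp add: sum.atMost_Suc_shift weyl_poly_def sum_distrib_left wscale_times_right
        del: sum.atMost_Suc)
qed

lemma weyl_poly_smult: "weyl_poly (smult a p) P = wscale a (weyl_poly p P)"
  by (induction p) (simp_all add: weyl_poly_pCons wmod.scale_right_distrib wscale_times_right)

lemma weyl_poly_mult: "weyl_poly (p * q) P = weyl_poly p P * weyl_poly q P"
  by (induction p)
    (simp_all add: weyl_poly_pCons weyl_poly_add weyl_poly_smult wscale_times_left
      distrib_right mult.assoc)

lemma weyl_poly_commute_with:
  assumes "R * P = P * R"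
  shows "R * weyl_poly p P = weyl_poly p P * R"
proof (induction p)
  case (pCons a p)
  have "R * (P * weyl_poly p P) = P * weyl_poly p P * R"
    by (metis assms mult.assoc pCons.IH)
  then show ?case
    by (simp add: weyl_poly_pCons distrib_left distrib_right wscale_times_left wscale_times_right)
qed simp

text \<open>
  A nonzero element of least degree divides all others by division with remainder. The lemma serves
  both for \<open>{p. p(s) \<in> J}\<close> and for producing a greatest common divisor with its Bezout coefficients.
\<close>

lemma poly_ideal_principal:
  fixes T :: "'k::field poly set"
  assumes "b0 \<in> T" "b0 \<noteq> 0" and add: "\<And>p q. p \<in> T \<Longrightarrow> q \<in> T \<Longrightarrow> p + q \<in> T"
    and mult: "\<And>r p. p \<in> T \<Longrightarrow> r * p \<in> T"
  obtains g where "g \<in> T" "g \<noteq> 0" "\<And>p. p \<in> T \<Longrightarrow> g dvd p"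
proof -
  obtain g where g: "g \<in> T" "g \<noteq> 0" and min: "\<And>p. p \<in> T \<Longrightarrow> p \<noteq> 0 \<Longrightarrow> degree g \<le> degree p"
    using ex_has_least_nat[of "\<lambda>p. p \<in> T \<and> p \<noteq> 0" b0 degree] assms(1,2) by blast
  have "g dvd p" if p: "p \<in> T" for p
  proof (rule ccontr)
    assume "\<not> g dvd p"
    then have nz: "p mod g \<noteq> 0" by (simp add: dvd_eq_mod_eq_0)
    have "p mod g = p + (- (p div g)) * g" by (simp add: minus_div_mult_eq_mod[symmetric])
    then have "p mod g \<in> T" using add mult p g by metis
    then show False using min nz degree_mod_less'[OF g(2) nz] by fastforce
  qed
  then show thesis using that g by blast
qed

section \<open>Finite-dimensional linear algebra\<close>

text \<open>
  Gaussian elimination: an equation with a nonzero coefficient at \<open>t\<close> is solved for the unknown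
  \<open>t\<close> and substituted into the others.
\<close>

lemma homogeneous_system_nontrivial_solution:
  fixes A :: "'e \<Rightarrow> 's \<Rightarrow> 'k::field"
  assumes "finite E" "finite S" "card E < card S"
  obtains c where "\<exists>s\<in>S. c s \<noteq> 0" "\<And>e. e \<in> E \<Longrightarrow> (\<Sum>s\<in>S. c s * A e s) = 0"
proof -
  have "\<exists>c. (\<exists>s\<in>S. c s \<noteq> 0) \<and> (\<forall>e\<in>E. (\<Sum>s\<in>S. c s * A e s) = 0)"
    using assms
  proof (induction E arbitrary: S A rule: finite_induct)
    case empty
    then have "S \<noteq> {}" by auto
    then show ?case by (intro exI[of _ "\<lambda>_. 1"]) auto
  next
    case (insert e E)
    show ?case
    proof (cases "\<forall>s\<in>S. A e s = 0")
      case True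
      have "card E < card S" using insert by simp
      then obtain c where "\<exists>s\<in>S. c s \<noteq> 0" "\<forall>e\<in>E. (\<Sum>s\<in>S. c s * A e s) = 0"
        using insert.IH[of S A] insert.prems by blast
      with True show ?thesis by (intro exI[of _ c]) auto
    next
      case False
      then obtain t where t: "t \<in> S" "A e t \<noteq> 0" by blast
      define S' where "S' = S - {t}"
      have S': "finite S'" "card E < card S'" "t \<notin> S'" "S = insert t S'"
        using insert t by (auto simp: S'_def)
      define A' where "A' = (\<lambda>e' s. A e' s - A e' t * A e s / A e t)"
      obtain c where c: "\<exists>s\<in>S'. c s \<noteq> 0" "\<forall>e'\<in>E. (\<Sum>s\<in>S'. c s * A' e' s) = 0"
        using insert.IH[of S' A'] S' by blast
      define a where "a = - (\<Sum>s\<in>S'. c s * A e s) / A e t"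
      define c' where "c' = c(t := a)"
      have sum: "(\<Sum>s\<in>S. c' s * A e' s) = a * A e' t + (\<Sum>s\<in>S'. c s * A e' s)" for e'
      proof -
        have "(\<Sum>s\<in>S'. c' s * A e' s) = (\<Sum>s\<in>S'. c s * A e' s)"
          by (rule sum.cong) (use S' in \<open>auto simp: c'_def\<close>)
        then show ?thesis using S' by (simp add: c'_def)
      qed
      have "(\<Sum>s\<in>S. c' s * A e' s) = 0" if "e' \<in> insert e E" for e'
      proof (cases "e' = e")
        case True
        then show ?thesis unfolding sum using t by (simp add: a_def)
      next
        case False
        then have "(\<Sum>s\<in>S'. c s * A' e' s) = 0" using c that by blast
        moreover have "(\<Sum>s\<in>S'. c s * A' e' s) =
            (\<Sum>s\<in>S'. c s * A e' s) - A e' t / A e t * (\<Sum>s\<in>S'. c s * A e s)"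
          unfolding A'_def sum_distrib_left sum_subtractf[symmetric]
          by (rule sum.cong) (auto simp: field_simps)
        ultimately show ?thesis unfolding sum a_def by (simp add: field_simps)
      qed
      moreover have "\<exists>s\<in>S. c' s \<noteq> 0" using c S' by (auto simp: c'_def)
      ultimately show ?thesis by blast
    qed
  qed
  then show thesis using that by blast
qed

text \<open>
  Extend a basis of \<open>W\<close> to one of \<open>V\<close>: the added vectors \<open>U\<close> and their coordinate functions \<open>f\<close>
  represent the quotient \<open>V/W\<close> without forming it.
\<close>

lemma (in vector_space) complement_coordinates:
  assumes V: "V = span X" "finite X" and W: "subspace W" "W \<subseteq> V"
  obtains U f where "finite U" "U \<subseteq> V" "card U = dim V - dim W"
    "\<And>v. v \<in> V \<Longrightarrow> v - (\<Sum>u\<in>U. scale (f u v) u) \<in> W"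
    "\<And>u (S :: 'x set) c g. g ` S \<subseteq> V \<Longrightarrow> f u (\<Sum>x\<in>S. scale (c x) (g x)) = (\<Sum>x\<in>S. c x * f u (g x))"
proof -
  obtain B where B: "B \<subseteq> W" "independent B" "W \<subseteq> span B" "card B = dim W"
    using basis_exists[of W] by blast
  obtain C where C: "B \<subseteq> C" "C \<subseteq> V" "independent C" "V \<subseteq> span C"
    using maximal_independent_subset_extend[of B V] B W by blast
  have subV: "subspace V" using V by simp
  have fin: "finite C" using independent_span_bound[of X C] C V by auto
  have cardC: "card C = dim V" using C by (intro basis_card_eq_dim)
  have spanC: "span C = V" using C subV span_minimal[of C V] by blast
  define f where "f = (\<lambda>u v. representation C v u)"
  show thesis
  proof (rule that[of "C - B" f])
    show "finite (C - B)" "C - B \<subseteq> V" using fin C by auto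
    show "card (C - B) = dim V - dim W"
      using fin C B cardC card_Diff_subset[of B C] finite_subset by metis
    show "v - (\<Sum>u\<in>C - B. scale (f u v) u) \<in> W" if "v \<in> V" for v
    proof -
      have "v = (\<Sum>u\<in>C. scale (f u v) u)"
        unfolding f_def using sum_representation_eq[OF C(3) _ fin order_refl, of v] that spanC by simp
      also have "\<dots> = (\<Sum>u\<in>C - B. scale (f u v) u) + (\<Sum>u\<in>B. scale (f u v) u)"
        using fin C(1) by (rule sum.subset_diff[rotated])
      finally have "v - (\<Sum>u\<in>C - B. scale (f u v) u) = (\<Sum>u\<in>B. scale (f u v) u)"
        by (simp add: diff_eq_eq add.commute)
      then show ?thesis using B W by (auto intro!: subspace_sum subspace_scale)
    qed
    show "f u (\<Sum>x\<in>S. scale (c x) (g x)) = (\<Sum>x\<in>S. c x * f u (g x))" if "g ` S \<subseteq> V"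
      for u and S :: "'x set" and c g
    proof (cases "finite S")
      case True
      then show ?thesis using that
      proof (induction S rule: finite_induct)
        case empty
        then show ?case by (simp add: f_def representation_zero)
      next
        case (insert x S)
        then have "(\<Sum>x\<in>S. scale (c x) (g x)) \<in> V" using subV by (auto intro!: subspace_sum subspace_scale)
        moreover have "scale (c x) (g x) \<in> V" using insert subV by (auto intro!: subspace_scale)
        ultimately show ?case
          using insert spanC
          by (simp add: f_def representation_add[OF C(3)] representation_scale[OF C(3)])
      qed
    qed (simp add: f_def representation_zero)
  qed
qed

section \<open>Passing to symbols does not increase the Hilbert function\<close>

lemma bernstein_sigmaV:
  assumes "P \<in> bernstein_filtration k"
  shows "sigmaV w P \<in> bernstein_filtration k"
  using assms by (fastforce simp: bernstein_filtration_iff sigmaV_eq wsupp_def wcoeff_Vpart)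

text \<open>
  Choose a largest set \<open>B\<close> of elements of \<open>W\<close> whose symbols are distinct and linearly independent.
  By maximality the symbol of any \<open>P \<in> W\<close> is a combination of symbols of elements of \<open>B\<close>; since
  symbols are homogeneous, only those of the same order are needed, and subtracting the
  corresponding combination of elements of \<open>B\<close> from \<open>P\<close> lowers the order. Only finitely many orders
  occur within the bounded total degree, so \<open>B\<close> spans \<open>W\<close>.
\<close>

lemma dim_le_dim_symbols:
  fixes W :: "('n::finite, 'k::field) weyl set"
  assumes W: "wmod.subspace W" "W \<subseteq> bernstein_filtration k"
    and Z: "\<And>P. P \<in> W \<Longrightarrow> P \<noteq> 0 \<Longrightarrow> sigmaV w P \<in> Z" "Z \<subseteq> bernstein_filtration k"
  shows "wvs.dim W \<le> wvs.dim Z"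
proof -
  obtain X :: "('n, 'k) weyl set" where X: "finite X" "bernstein_filtration k = wmod.span X"
    using bernstein_finite_span by blast
  define good where "good = (\<lambda>B. B \<subseteq> W - {0} \<and> inj_on (sigmaV w) B \<and> wmod.independent (sigmaV w ` B))"
  have bound: "finite B \<and> card B \<le> wvs.dim Z" if "good B" for B
  proof -
    have ind: "wmod.independent (sigmaV w ` B)" using that by (simp add: good_def)
    have sub: "sigmaV w ` B \<subseteq> Z" using that Z by (auto simp: good_def)
    then have "finite (sigmaV w ` B)"
      using wvs.independent_span_bound[OF X(1), of "sigmaV w ` B"] that Z X by (auto simp: good_def)
    obtain Y where Y: "sigmaV w ` B \<subseteq> Y" "Y \<subseteq> Z" "wmod.independent Y" "Z \<subseteq> wmod.span Y"
      using wvs.maximal_independent_subset_extend[OF sub ind] by blast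
    have "finite Y" using wvs.independent_span_bound[OF X(1) Y(3)] Y Z X by auto
    then have "card (sigmaV w ` B) \<le> card Y" using Y by (intro card_mono)
    also have "card Y = wvs.dim Z" using Y by (intro wvs.basis_card_eq_dim)
    finally show ?thesis
      using that \<open>finite (sigmaV w ` B)\<close> by (auto simp: good_def card_image dest: finite_imageD)
  qed
  have "good {}" by (simp add: good_def wmod.independent_empty)
  moreover have "\<forall>B. good B \<longrightarrow> card B < Suc (wvs.dim Z)" using bound by (simp add: less_Suc_eq_le)
  ultimately obtain B where B: "good B" and max: "\<And>B'. good B' \<Longrightarrow> card B' \<le> card B"
    using ex_has_greatest_nat[of good "{}" card "Suc (wvs.dim Z)"] by blast
  define levels where "levels = Vweight w ` {(\<alpha> :: nat ^ 'n, \<beta> :: nat ^ 'n). (\<Sum>i\<in>UNIV. \<alpha> $ i + \<beta> $ i) \<le> k}"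
  have fin: "finite levels" unfolding levels_def using finite_bounded_degree by (rule finite_imageI)
  have lev: "ordV w P \<in> levels" if "P \<in> W" "P \<noteq> 0" for P
  proof -
    obtain m where "m \<in> wsupp P" "Vweight w m = ordV w P" using ordV_attained \<open>P \<noteq> 0\<close> by blast
    then show ?thesis using that W by (force simp: bernstein_filtration_iff levels_def)
  qed
  \<comment> \<open>the induction is on the number of possible orders up to the order of \<open>P\<close>\<close>
  have spanB: "P \<in> wmod.span B" if "P \<in> W" for P
    using that
  proof (induction "card {l \<in> levels. P \<noteq> 0 \<and> l \<le> ordV w P}" arbitrary: P rule: less_induct)
    case less
    show ?case
    proof (cases "P = 0")
      case False
      have inspan: "sigmaV w P \<in> wmod.span (sigmaV w ` B)"
      proof (rule ccontr)
        assume n: "sigmaV w P \<notin> wmod.span (sigmaV w ` B)"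
        then have "sigmaV w P \<notin> sigmaV w ` B" by (meson wmod.span_base)
        moreover have "wmod.independent (sigmaV w ` insert P B)"
          using wvs.independent_insertI[OF n] B by (simp add: good_def)
        ultimately have "good (insert P B)"
          using B less.prems False by (auto simp: good_def)
        moreover have "P \<notin> B" using \<open>sigmaV w P \<notin> sigmaV w ` B\<close> by blast
        ultimately show False using max bound[OF B] by fastforce
      qed
      then obtain c where c: "sigmaV w P = (\<Sum>b\<in>B. wscale (c b) (sigmaV w b))"
      proof -
        have "finite (sigmaV w ` B)" using bound[OF B] by simp
        then obtain u where "sigmaV w P = (\<Sum>v\<in>sigmaV w ` B. wscale (u v) v)"
          using inspan by (auto simp: wmod.span_finite)
        also have "\<dots> = (\<Sum>b\<in>B. wscale (u (sigmaV w b)) (sigmaV w b))"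
          using B by (simp add: good_def sum.reindex)
        finally show thesis using that[of "\<lambda>b. u (sigmaV w b)"] by blast
      qed
      define d where "d = ordV w P"
      define B' where "B' = {b \<in> B. ordV w b = d}"
      define Q where "Q = P - (\<Sum>b\<in>B'. wscale (c b) b)"
      have finB: "finite B" "B' \<subseteq> B" "B \<subseteq> W" using bound[OF B] B by (auto simp: B'_def good_def)
      have inW: "(\<Sum>b\<in>B'. wscale (c b) b) \<in> W"
        using finB W by (auto intro!: wmod.subspace_sum wmod.subspace_scale)
      then have QW: "Q \<in> W" unfolding Q_def using W less.prems by (intro wmod.subspace_diff)
      have "Vpart w d P = Vpart w d (sigmaV w P)"
        by (simp add: d_def sigmaV_eq Vpart_Vhom[OF Vhom_Vpart])
      also have "\<dots> = (\<Sum>b\<in>B. wscale (c b) (if d = ordV w b then sigmaV w b else 0))"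
        unfolding c Vpart_sum Vpart_scale
        by (simp add: sigmaV_eq Vpart_Vhom[OF Vhom_Vpart] cong: if_cong)
      also have "\<dots> = (\<Sum>b\<in>B'. wscale (c b) (Vpart w d b))"
        by (rule sum.mono_neutral_cong_right) (use finB in \<open>auto simp: B'_def sigmaV_eq\<close>)
      finally have "Vpart w d Q = 0"
        unfolding Q_def by (simp add: Vpart_diff Vpart_sum Vpart_scale)
      have small: "ordV w Q < d" if "Q \<noteq> 0"
      proof -
        obtain m where m: "m \<in> wsupp Q" "Vweight w m = ordV w Q" using ordV_attained \<open>Q \<noteq> 0\<close> by blast
        have "Vweight w m \<noteq> d"
          using m(1) arg_cong[OF \<open>Vpart w d Q = 0\<close>, of "\<lambda>P. wcoeff P m"]
          by (auto simp: wsupp_def wcoeff_Vpart)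
        moreover have "Vweight w m \<le> d"
        proof -
          have "m \<in> wsupp P \<or> (\<exists>b\<in>B'. m \<in> wsupp b)"
          proof (rule ccontr)
            assume "\<not> ?thesis"
            then have "wcoeff P m = 0" "\<forall>b\<in>B'. wcoeff b m = 0" by (auto simp: wsupp_def)
            then have "wcoeff (Q + (\<Sum>b\<in>B'. wscale (c b) b)) m = wcoeff Q m"
              by (simp add: wcoeff_sum)
            then show False using m(1) \<open>wcoeff P m = 0\<close> by (simp add: Q_def wsupp_def)
          qed
          then show ?thesis using Vweight_le_ordV[of m P w] Vweight_le_ordV[of m _ w]
            unfolding d_def B'_def by fastforce
        qed
        ultimately show ?thesis using m by simp
      qed
      have "{l \<in> levels. Q \<noteq> 0 \<and> l \<le> ordV w Q} \<subset> {l \<in> levels. P \<noteq> 0 \<and> l \<le> ordV w P}"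
      proof
        show "{l \<in> levels. Q \<noteq> 0 \<and> l \<le> ordV w Q} \<subseteq> {l \<in> levels. P \<noteq> 0 \<and> l \<le> ordV w P}"
          using small False by (auto simp: d_def)
        have "d \<in> {l \<in> levels. P \<noteq> 0 \<and> l \<le> ordV w P}" "d \<notin> {l \<in> levels. Q \<noteq> 0 \<and> l \<le> ordV w Q}"
          using small False lev less.prems by (auto simp: d_def)
        then show "{l \<in> levels. Q \<noteq> 0 \<and> l \<le> ordV w Q} \<noteq> {l \<in> levels. P \<noteq> 0 \<and> l \<le> ordV w P}"
          by blast
      qed
      then have "card {l \<in> levels. Q \<noteq> 0 \<and> l \<le> ordV w Q} < card {l \<in> levels. P \<noteq> 0 \<and> l \<le> ordV w P}"
        using fin by (intro psubset_card_mono) auto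
      then have "Q \<in> wmod.span B" using less.hyps QW by blast
      moreover have "(\<Sum>b\<in>B'. wscale (c b) b) \<in> wmod.span B"
        by (intro wmod.span_sum wmod.span_scale wmod.span_base) (use finB in blast)
      ultimately have "Q + (\<Sum>b\<in>B'. wscale (c b) b) \<in> wmod.span B" by (rule wmod.span_add)
      then show ?thesis by (simp add: Q_def)
    qed (simp add: wmod.span_zero)
  qed
  then have "wvs.dim W \<le> card B" using bound[OF B] by (intro wvs.dim_le_card) auto
  then show ?thesis using bound[OF B] by simp
qed

text \<open>
  Taking the symbol only drops monomials, hence it preserves the Bernstein filtration.
\<close>

lemma hilbert_fun_grV_le:
  assumes "left_ideal I"
  shows "hilbert_fun (grV w I) k \<le> hilbert_fun I k"
proof -
  have "wvs.dim (bernstein_filtration k \<inter> I) \<le> wvs.dim (bernstein_filtration k \<inter> grV w I)"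
  proof (rule dim_le_dim_symbols)
    show "wmod.subspace (bernstein_filtration k \<inter> I)"
      using assms by (intro wmod.subspace_inter subspace_bernstein left_ideal_subspace)
    show "sigmaV w P \<in> bernstein_filtration k \<inter> grV w I"
      if "P \<in> bernstein_filtration k \<inter> I" "P \<noteq> 0" for P
      using that bernstein_sigmaV by (auto simp: grV_def intro: wmod.span_base)
  qed auto
  then show ?thesis by (simp add: hilbert_fun_def)
qed

section \<open>Polynomials in an ideal of small growth\<close>

text \<open>
  Up to sign, the commutators with \<open>x\<^sub>i\<close> and \<open>\<partial>\<^sub>i\<close> differentiate formally with respect to \<open>\<partial>\<^sub>i\<close> and
  \<open>x\<^sub>i\<close>. They lower the total degree, and in characteristic 0 only constants are killed by all of them.
\<close>

lemma times_wX_minus: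
  fixes P :: "('a::finite, 'b::comm_ring_1) weyl"
  shows "wcoeff (P * wX i - wX i * P) (\<alpha>, \<beta>) = of_nat (\<beta> $ i + 1) * wcoeff P (\<alpha>, axis i 1 + \<beta>)"
proof (induction P rule: weyl_add_induct)
  case (mono c \<gamma> \<delta>)
  have "wscale c (wmono \<gamma> \<delta>) * wX i - wX i * wscale c (wmono \<gamma> \<delta>) =
      wscale (c * of_nat (\<delta> $ i)) (wmono \<gamma> (\<delta> - axis i 1) :: ('a, 'b) weyl)"
    by (simp add: wscale_times_left wscale_times_right wmono_times_wX wX_times_wmono
        wmod.scale_right_distrib)
  moreover have "\<delta> $ i \<noteq> 0 \<and> \<beta> = \<delta> - axis i 1 \<longleftrightarrow> \<delta> = axis i 1 + \<beta>"
    by (auto simp: vec_eq_iff axis_def)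
  ultimately show ?case by (auto simp: wcoeff_mono simp del: wcoeff_diff)
qed (simp_all add: weyl_distrib_left weyl_distrib_right algebra_simps)

lemma wD_times_minus:
  fixes P :: "('a::finite, 'b::comm_ring_1) weyl"
  shows "wcoeff (wD i * P - P * wD i) (\<alpha>, \<beta>) = of_nat (\<alpha> $ i + 1) * wcoeff P (axis i 1 + \<alpha>, \<beta>)"
proof (induction P rule: weyl_add_induct)
  case (mono c \<gamma> \<delta>)
  have "wD i * wscale c (wmono \<gamma> \<delta>) - wscale c (wmono \<gamma> \<delta>) * wD i =
      wscale (c * of_nat (\<gamma> $ i)) (wmono (\<gamma> - axis i 1) \<delta> :: ('a, 'b) weyl)"
    by (simp add: wscale_times_left wscale_times_right wmono_times_wD wD_times_wmono
        wmod.scale_right_distrib)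
  moreover have "\<gamma> $ i \<noteq> 0 \<and> \<alpha> = \<gamma> - axis i 1 \<longleftrightarrow> \<gamma> = axis i 1 + \<alpha>"
    by (auto simp: vec_eq_iff axis_def)
  ultimately show ?case by (auto simp: wcoeff_mono simp del: wcoeff_diff)
qed (simp_all add: weyl_distrib_left weyl_distrib_right algebra_simps)

lemma sum_axis_plus: "(\<Sum>j\<in>UNIV. (axis i 1 + \<beta>) $ j) = Suc (\<Sum>j\<in>UNIV. \<beta> $ j)" for \<beta> :: "nat ^ 'n::finite"
proof -
  have "(\<Sum>j\<in>UNIV. (axis i 1 :: nat ^ 'n) $ j) = 1" by (simp add: axis_def)
  then show ?thesis by (simp only: vector_add_component sum.distrib)
qed

lemma commutator_wX_bernstein:
  assumes "P \<in> bernstein_filtration (Suc k)"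
  shows "P * wX i - wX i * P \<in> bernstein_filtration k"
  unfolding bernstein_filtration_iff
proof safe
  fix \<alpha> \<beta> assume "(\<alpha>, \<beta>) \<in> wsupp (P * wX i - wX i * P)"
  then have "(\<alpha>, axis i 1 + \<beta>) \<in> wsupp P" by (auto simp: wsupp_def times_wX_minus simp del: wcoeff_diff)
  then have "(\<Sum>j\<in>UNIV. \<alpha> $ j + (axis i 1 + \<beta>) $ j) \<le> Suc k"
    using assms unfolding bernstein_filtration_iff by blast
  then show "(\<Sum>j\<in>UNIV. \<alpha> $ j + \<beta> $ j) \<le> k"
    unfolding sum.distrib sum_axis_plus by simp
qed

lemma commutator_wD_bernstein:
  assumes "P \<in> bernstein_filtration (Suc k)"
  shows "wD i * P - P * wD i \<in> bernstein_filtration k"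
  unfolding bernstein_filtration_iff
proof safe
  fix \<alpha> \<beta> assume "(\<alpha>, \<beta>) \<in> wsupp (wD i * P - P * wD i)"
  then have "(axis i 1 + \<alpha>, \<beta>) \<in> wsupp P" by (auto simp: wsupp_def wD_times_minus simp del: wcoeff_diff)
  then have "(\<Sum>j\<in>UNIV. (axis i 1 + \<alpha>) $ j + \<beta> $ j) \<le> Suc k"
    using assms unfolding bernstein_filtration_iff by blast
  then show "(\<Sum>j\<in>UNIV. \<alpha> $ j + \<beta> $ j) \<le> k"
    unfolding sum.distrib sum_axis_plus by simp
qed

lemma weyl_center:
  fixes P :: "('n::finite, 'k::field_char_0) weyl"
  assumes X: "\<And>i. P * wX i = wX i * P" and D: "\<And>i. wD i * P = P * wD i"
  shows "P = wscale (wcoeff P (0, 0)) 1"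
proof (rule weyl_eqI)
  fix m :: "(nat ^ 'n) \<times> (nat ^ 'n)"
  obtain \<alpha> \<beta> where m: "m = (\<alpha>, \<beta>)" by fastforce
  have split: "\<gamma> = axis i 1 + (\<gamma> - axis i 1)" if "\<gamma> $ i \<noteq> 0" for \<gamma> :: "nat ^ 'n" and i
    using that by (auto simp: vec_eq_iff axis_def)
  have nz: "of_nat (a + 1) \<noteq> (0 :: 'k)" for a by (simp only: of_nat_eq_0_iff)
  have "wcoeff P m = 0" if "m \<noteq> (0, 0)"
  proof -
    from that m have "\<alpha> \<noteq> 0 \<or> \<beta> \<noteq> 0" by simp
    then consider i where "\<alpha> $ i \<noteq> 0" | i where "\<beta> $ i \<noteq> 0" by (auto simp: vec_eq_iff)
    then show ?thesis
    proof cases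
      case 1
      have "of_nat ((\<alpha> - axis i 1) $ i + 1) * wcoeff P (axis i 1 + (\<alpha> - axis i 1), \<beta>) = 0"
        unfolding wD_times_minus[symmetric] by (simp add: D)
      then show ?thesis using nz split[OF 1] m by (metis mult_eq_0_iff)
    next
      case 2
      have "of_nat ((\<beta> - axis i 1) $ i + 1) * wcoeff P (\<alpha>, axis i 1 + (\<beta> - axis i 1)) = 0"
        unfolding times_wX_minus[symmetric] by (simp add: X)
      then show ?thesis using nz split[OF 2] m by (metis mult_eq_0_iff)
    qed
  qed
  then show "wcoeff P m = wcoeff (wscale (wcoeff P (0, 0)) 1) m"
    by (auto simp: one_weyl_def wcoeff_mono)
qed

lemma wX_bernstein: "wX i \<in> bernstein_filtration (Suc 0)"
  by (auto simp: bernstein_filtration_iff wX_def axis_def sum.distrib)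

lemma wD_bernstein: "wD i \<in> bernstein_filtration (Suc 0)"
  by (auto simp: bernstein_filtration_iff wD_def axis_def sum.distrib)

text \<open>
  If \<open>\<Sum>\<^sub>j P\<^sub>j t\<^sup>j\<close> annihilates the image of \<open>F\<^sub>k\<^sub>+\<^sub>1\<close> in \<open>D/J\<close>, then its commutators with the generators
  \<open>x\<^sub>i\<close>, \<open>\<partial>\<^sub>i\<close> have coefficients in \<open>F\<^sub>k\<close> and annihilate the image of \<open>F\<^sub>k\<close>. By induction they vanish,
  so all \<open>P\<^sub>j\<close> are constants, and applying the operator to \<open>1\<close> produces a polynomial in \<open>s\<close> in \<open>J\<close>.
\<close>

lemma bernstein_faithful:
  fixes J :: "('n::finite, 'k::field_char_0) weyl set"
  assumes J: "left_ideal J" and s: "\<And>p. weyl_poly p s \<in> J \<Longrightarrow> p = 0"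
    and P: "\<And>j. j \<le> N \<Longrightarrow> P j \<in> bernstein_filtration k"
    and kill: "\<And>Q. Q \<in> bernstein_filtration k \<Longrightarrow> (\<Sum>j\<le>N. P j * Q * s ^ j) \<in> J"
  shows "\<forall>j\<le>N. P j = 0"
proof -
  have scalars: "\<forall>j\<le>N. P j = 0"
    if c: "\<And>j. j \<le> N \<Longrightarrow> P j = wscale (c j) 1" and "(\<Sum>j\<le>N. P j * 1 * s ^ j) \<in> J" for P c
  proof -
    define p where "p = (\<Sum>j\<le>N. monom (c j) j)"
    have coeff: "coeff p j = (if j \<le> N then c j else 0)" for j
      by (simp add: p_def coeff_sum)
    have "degree p \<le> N" by (intro degree_le) (simp add: coeff)
    then have "weyl_poly p s = (\<Sum>j\<le>N. P j * 1 * s ^ j)"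
      by (simp add: weyl_poly_superset coeff c wscale_times_left)
    then have "p = 0" using s that by simp
    then have "c j = 0" if "j \<le> N" for j using coeff[of j] that by simp
    then show ?thesis using c by simp
  qed
  show ?thesis
    using P kill
  proof (induction k arbitrary: P)
  case (Suc k)
    have mono: "bernstein_filtration k \<subseteq> (bernstein_filtration (Suc k) :: ('n, 'k) weyl set)"
      by (rule bernstein_mono) simp
    have step: "\<forall>j\<le>N. g * P j = P j * g"
      if g: "g \<in> bernstein_filtration (Suc 0)"
        and c: "\<And>j. j \<le> N \<Longrightarrow> P j * g - g * P j \<in> bernstein_filtration k" for g
    proof -
      have "\<forall>j\<le>N. P j * g - g * P j = 0"
      proof (rule Suc.IH[OF c])
        fix Q :: "('n, 'k) weyl" assume Q: "Q \<in> bernstein_filtration k"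
        then have "g * Q \<in> bernstein_filtration (Suc k)" using bernstein_times[OF g Q] by simp
        then have "(\<Sum>j\<le>N. P j * (g * Q) * s ^ j) \<in> J" using Suc.prems by blast
        moreover have "g * (\<Sum>j\<le>N. P j * Q * s ^ j) \<in> J"
          using Suc.prems(2)[of Q] Q mono J by (auto simp: left_ideal_def)
        ultimately have "(\<Sum>j\<le>N. P j * (g * Q) * s ^ j) - g * (\<Sum>j\<le>N. P j * Q * s ^ j) \<in> J"
          by (rule left_ideal_minus[OF J])
        also have "(\<Sum>j\<le>N. P j * (g * Q) * s ^ j) - g * (\<Sum>j\<le>N. P j * Q * s ^ j) =
            (\<Sum>j\<le>N. (P j * g - g * P j) * Q * s ^ j)"
          by (simp add: sum_distrib_left sum_subtractf[symmetric] left_diff_distrib mult.assoc)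
        finally show "(\<Sum>j\<le>N. (P j * g - g * P j) * Q * s ^ j) \<in> J" .
      qed
      then show ?thesis by simp
    qed
    have "\<forall>j\<le>N. wX i * P j = P j * wX i" for i
      by (rule step[OF wX_bernstein]) (intro commutator_wX_bernstein Suc.prems)
    moreover have "\<forall>j\<le>N. wD i * P j = P j * wD i" for i
    proof (rule step[OF wD_bernstein])
      fix j assume "j \<le> N"
      then have "wD i * P j - P j * wD i \<in> bernstein_filtration k"
        by (intro commutator_wD_bernstein Suc.prems)
      then have "- (wD i * P j - P j * wD i) \<in> bernstein_filtration k"
        by (rule wmod.subspace_neg[OF subspace_bernstein])
      then show "P j * wD i - wD i * P j \<in> bernstein_filtration k" by simp
    qed
    ultimately have scalar: "P j = wscale (wcoeff (P j) (0, 0)) 1" if "j \<le> N" for j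
      using that by (intro weyl_center) auto
    moreover have "1 \<in> bernstein_filtration (Suc k)" using bernstein_mono[of 0 "Suc k"] one_in_bernstein by blast
    ultimately show ?case using scalars[of P "\<lambda>j. wcoeff (P j) (0, 0)"] Suc.prems by blast
  next
    case 0
    have "P j = wscale (wcoeff (P j) (0, 0)) 1" if "j \<le> N" for j
    proof (rule weyl_eqI)
      fix m :: "(nat ^ 'n) \<times> (nat ^ 'n)"
      have "m \<in> wsupp (P j) \<Longrightarrow> m = (0, 0)"
        using 0(1)[OF that] by (cases m) (auto simp: bernstein_filtration_iff vec_eq_iff)
      then show "wcoeff (P j) m = wcoeff (wscale (wcoeff (P j) (0, 0)) 1) m"
        by (auto simp: one_weyl_def wcoeff_mono wsupp_def)
    qed
    then show ?case
      using scalars[of P "\<lambda>j. wcoeff (P j) (0, 0)"] 0(2)[OF one_in_bernstein] by blast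
  qed
qed

lemma bernstein_coordinates_modulo:
  fixes J :: "('n::finite, 'k::field) weyl set"
  assumes J: "left_ideal J"
  obtains U f where "finite U" "U \<subseteq> bernstein_filtration l" "card U = hilbert_fun J l"
    "\<And>v. v \<in> bernstein_filtration l \<Longrightarrow> v - (\<Sum>u\<in>U. wscale (f u v) u) \<in> J"
    "\<And>u (S :: 'x set) c g. g ` S \<subseteq> bernstein_filtration l \<Longrightarrow>
      f u (\<Sum>x\<in>S. wscale (c x) (g x)) = (\<Sum>x\<in>S. c x * f u (g x))"
proof -
  obtain X :: "('n, 'k) weyl set" where X: "finite X" "bernstein_filtration l = wmod.span X"
    using bernstein_finite_span by blast
  have sub: "wmod.subspace (bernstein_filtration l \<inter> J)" "bernstein_filtration l \<inter> J \<subseteq> bernstein_filtration l"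
    using left_ideal_subspace[OF J] by (auto intro: wmod.subspace_inter subspace_bernstein)
  show thesis
  proof (rule wvs.complement_coordinates[OF X(2,1) sub])
    fix U and f :: "('n, 'k) weyl \<Rightarrow> ('n, 'k) weyl \<Rightarrow> 'k"
    assume U: "finite U" "U \<subseteq> bernstein_filtration l"
      "card U = wvs.dim (bernstein_filtration l :: ('n, 'k) weyl set) - wvs.dim (bernstein_filtration l \<inter> J)"
      and f: "\<And>v. v \<in> bernstein_filtration l \<Longrightarrow>
        v - (\<Sum>u\<in>U. wscale (f u v) u) \<in> bernstein_filtration l \<inter> J"
      and lin: "\<And>u (S :: 'x set) c g. g ` S \<subseteq> bernstein_filtration l \<Longrightarrow>
        f u (\<Sum>x\<in>S. wscale (c x) (g x)) = (\<Sum>x\<in>S. c x * f u (g x))"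
    show thesis
      by (rule that[of U f, OF U(1,2) _ _ lin]) (use U f in \<open>auto simp: hilbert_fun_def\<close>)
  qed
qed

text \<open>
  For \<open>Q \<in> F\<^sub>k\<close> and \<open>j \<le> k\<close>, the element \<open>x\<^sup>\<alpha> \<partial>\<^sup>\<beta> Q s\<^sup>j\<close> has total degree at most \<open>k + k + 2 k\<close>. Hence the
  condition that \<open>\<Sum>\<^sub>j P\<^sub>j Q s\<^sup>j \<in> J\<close> for all \<open>Q\<close> amounts to one linear equation for each pair of a basis
  vector of \<open>F\<^sub>k/(F\<^sub>k \<inter> J)\<close> and a coordinate of \<open>F\<^sub>4\<^sub>k/(F\<^sub>4\<^sub>k \<inter> J)\<close>, the unknowns being the coefficients
  of the \<open>P\<^sub>j\<close> at the monomials in \<open>M\<close>. That \<open>J s \<subseteq> J\<close> makes the condition independent of the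
  representative of \<open>Q\<close> modulo \<open>J\<close>.
\<close>

lemma annihilating_family:
  fixes J :: "('n::finite, 'k::field) weyl set" and M :: "((nat ^ 'n) \<times> (nat ^ 'n)) set"
  assumes J: "left_ideal J" and Js: "\<And>P. P \<in> J \<Longrightarrow> P * s \<in> J"
    and s: "s \<in> bernstein_filtration 2"
    and M: "finite M" "\<And>\<alpha> \<beta>. (\<alpha>, \<beta>) \<in> M \<Longrightarrow> (\<Sum>i\<in>UNIV. \<alpha> $ i + \<beta> $ i) \<le> k"
    and card: "hilbert_fun J k * hilbert_fun J (4 * k) < card M * Suc k"
  obtains P where "\<And>j. P j \<in> bernstein_filtration k" "\<exists>j\<le>k. P j \<noteq> 0"
    "\<And>Q. Q \<in> bernstein_filtration k \<Longrightarrow> (\<Sum>j\<le>k. P j * Q * s ^ j) \<in> J"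
proof -
  obtain U f where U: "finite U" "U \<subseteq> bernstein_filtration k" "card U = hilbert_fun J k"
    and f: "\<And>v. v \<in> bernstein_filtration k \<Longrightarrow> v - (\<Sum>u\<in>U. wscale (f u v) u) \<in> J"
    by (rule bernstein_coordinates_modulo[OF J, of k]) (rule that, assumption+)
  obtain U' f' where U': "finite U'" "card U' = hilbert_fun J (4 * k)"
    and f': "\<And>v. v \<in> bernstein_filtration (4 * k) \<Longrightarrow> v - (\<Sum>u\<in>U'. wscale (f' u v) u) \<in> J"
    and lin: "\<And>u (S :: (((nat ^ 'n) \<times> (nat ^ 'n)) \<times> nat) set) c g. g ` S \<subseteq> bernstein_filtration (4 * k) \<Longrightarrow>
        f' u (\<Sum>x\<in>S. wscale (c x) (g x)) = (\<Sum>x\<in>S. c x * f' u (g x))"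
    by (rule bernstein_coordinates_modulo[OF J, of "4 * k"]) (rule that, assumption+)
  define S where "S = M \<times> {..k}"
  define t where "t = (\<lambda>Q (x :: ((nat ^ 'n) \<times> (nat ^ 'n)) \<times> nat). wmono (fst (fst x)) (snd (fst x)) * Q * s ^ snd x)"
  have inM: "wmono (fst m) (snd m) \<in> (bernstein_filtration k :: ('n, 'k) weyl set)" if "m \<in> M" for m
    using M(2)[of "fst m" "snd m"] that by (simp add: bernstein_filtration_iff case_prod_unfold)
  have t4: "t Q x \<in> bernstein_filtration (4 * k)" if "Q \<in> bernstein_filtration k" "x \<in> S" for Q x
  proof -
    have "s ^ snd x \<in> bernstein_filtration (snd x * 2)" by (rule bernstein_power[OF s])
    moreover have "snd x * 2 \<le> 2 * k" using that by (auto simp: S_def)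
    ultimately have "s ^ snd x \<in> bernstein_filtration (2 * k)" using bernstein_mono by blast
    then have "t Q x \<in> bernstein_filtration (k + k + 2 * k)"
      unfolding t_def using that by (intro bernstein_times inM) (auto simp: S_def)
    then show ?thesis by simp
  qed
  have "finite (U \<times> U')" "finite S" "card (U \<times> U') < card S"
    using U U' M(1) card by (auto simp: S_def card_cartesian_product)
  then obtain c where c: "\<exists>x\<in>S. c x \<noteq> 0"
    and eqs: "\<And>e. e \<in> U \<times> U' \<Longrightarrow> (\<Sum>x\<in>S. c x * f' (snd e) (t (fst e) x)) = 0"
    by (rule homogeneous_system_nontrivial_solution[of "U \<times> U'" S "\<lambda>e x. f' (snd e) (t (fst e) x)"])
      (rule that, assumption+)
  have tU: "(\<Sum>x\<in>S. wscale (c x) (t u x)) \<in> J" if "u \<in> U" for u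
  proof -
    have "(\<Sum>x\<in>S. wscale (c x) (t u x)) \<in> bernstein_filtration (4 * k)"
      using that U t4 by (intro wmod.subspace_sum wmod.subspace_scale subspace_bernstein) auto
    moreover have "f' u' (\<Sum>x\<in>S. wscale (c x) (t u x)) = 0" if "u' \<in> U'" for u'
    proof -
      have "t u ` S \<subseteq> bernstein_filtration (4 * k)" using \<open>u \<in> U\<close> U t4 by blast
      then show ?thesis using lin[of "t u" S u' c] eqs[of "(u, u')"] that \<open>u \<in> U\<close> by simp
    qed
    ultimately show ?thesis using f'[of "\<Sum>x\<in>S. wscale (c x) (t u x)"] by simp
  qed
  have Js': "P * s ^ j \<in> J" if "P \<in> J" for P j
  proof (induction j)
    case (Suc j)
    then have "P * s ^ j * s \<in> J" by (rule Js)
    then show ?case by (simp add: power_Suc2 mult.assoc del: power_Suc)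
  qed (simp add: that)
  have subJ: "wmod.subspace J" by (rule left_ideal_subspace[OF J])
  have tQ: "(\<Sum>x\<in>S. wscale (c x) (t Q x)) \<in> J" if Q: "Q \<in> bernstein_filtration k" for Q
  proof -
    define R where "R = Q - (\<Sum>u\<in>U. wscale (f u Q) u)"
    have Q_eq: "Q = R + (\<Sum>u\<in>U. wscale (f u Q) u)" by (simp add: R_def)
    have "R \<in> J" using f[OF Q] by (simp add: R_def)
    then have "t R x \<in> J" for x
      using J Js' unfolding t_def left_ideal_def by blast
    then have 1: "(\<Sum>x\<in>S. wscale (c x) (t R x)) \<in> J"
      using subJ by (intro wmod.subspace_sum wmod.subspace_scale)
    have 2: "(\<Sum>u\<in>U. wscale (f u Q) (\<Sum>x\<in>S. wscale (c x) (t u x))) \<in> J"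
      by (rule wmod.subspace_sum[OF subJ], rule wmod.subspace_scale[OF subJ], rule tU)
    have tlin: "t Q x = t R x + (\<Sum>u\<in>U. wscale (f u Q) (t u x))" for x
      unfolding t_def by (subst Q_eq) (simp add: distrib_left distrib_right sum_distrib_left
          sum_distrib_right wscale_times_left wscale_times_right)
    have "(\<Sum>x\<in>S. wscale (c x) (t Q x)) = (\<Sum>x\<in>S. wscale (c x) (t R x)) +
        (\<Sum>x\<in>S. \<Sum>u\<in>U. wscale (f u Q) (wscale (c x) (t u x)))"
      unfolding tlin by (simp add: wmod.scale_right_distrib sum.distrib wmod.scale_sum_right mult.commute)
    also have "(\<Sum>x\<in>S. \<Sum>u\<in>U. wscale (f u Q) (wscale (c x) (t u x))) =
        (\<Sum>u\<in>U. wscale (f u Q) (\<Sum>x\<in>S. wscale (c x) (t u x)))"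
      by (subst sum.swap) (simp only: wmod.scale_sum_right)
    finally show ?thesis using wmod.subspace_add[OF subJ 1 2] by simp
  qed
  define P where "P = (\<lambda>j. \<Sum>m\<in>M. wscale (c (m, j)) (wmono (fst m) (snd m)))"
  show thesis
  proof (rule that[of P])
    show "P j \<in> bernstein_filtration k" for j
      unfolding P_def by (intro wmod.subspace_sum wmod.subspace_scale subspace_bernstein inM)
    obtain m j where mj: "m \<in> M" "j \<le> k" "c (m, j) \<noteq> 0" using c by (auto simp: S_def)
    have "wcoeff (P j) m = (\<Sum>x\<in>M. if m = x then c (x, j) else 0)"
      unfolding P_def wcoeff_sum by (intro sum.cong) (auto simp: wcoeff_mono)
    also have "\<dots> = c (m, j)" using mj M by (simp add: sum.delta')
    finally show "\<exists>j\<le>k. P j \<noteq> 0" using mj by force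
    show "(\<Sum>j\<le>k. P j * Q * s ^ j) \<in> J" if "Q \<in> bernstein_filtration k" for Q
    proof -
      have "(\<Sum>x\<in>S. wscale (c x) (t Q x)) = (\<Sum>m\<in>M. \<Sum>j\<le>k. wscale (c (m, j)) (t Q (m, j)))"
        by (simp add: S_def sum.cartesian_product case_prod_unfold)
      also have "\<dots> = (\<Sum>j\<le>k. \<Sum>m\<in>M. wscale (c (m, j)) (t Q (m, j)))" by (rule sum.swap)
      also have "\<dots> = (\<Sum>j\<le>k. P j * Q * s ^ j)"
        by (simp add: P_def t_def sum_distrib_right wscale_times_left)
      finally show ?thesis using tQ[OF that] by simp
    qed
  qed
qed

lemma holonomic_growth:
  fixes I :: "('n::finite, 'k::field) weyl set"
  assumes "holonomic I"
  obtains C :: nat where "\<forall>\<^sub>F k in sequentially. hilbert_fun I k \<le> C * k ^ CARD('n)"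
proof (cases "I = UNIV")
  case True
  then show thesis using that[of 0] by (simp add: hilbert_fun_def)
next
  case False
  then obtain h :: "rat poly" where h: "degree h = CARD('n)"
    and ev: "\<forall>\<^sub>F k in sequentially. of_nat (hilbert_fun I k) = poly h (of_nat k)"
    using assms by (auto simp: holonomic_def)
  define c where "c = (\<Sum>i\<le>degree h. \<bar>coeff h i\<bar>)"
  obtain C :: nat where C: "c \<le> of_nat C" using reals_Archimedean2[of c] less_imp_le by blast
  have "\<forall>\<^sub>F k in sequentially. hilbert_fun I k \<le> C * k ^ CARD('n)"
    using ev eventually_ge_at_top[of 1]
  proof eventually_elim
    case (elim k)
    have "of_nat (hilbert_fun I k) = (\<Sum>i\<le>degree h. coeff h i * of_nat k ^ i)"
      using elim by (simp add: poly_altdef)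
    also have "\<dots> \<le> (\<Sum>i\<le>degree h. \<bar>coeff h i\<bar> * of_nat k ^ CARD('n))"
      using elim h by (intro sum_mono mult_mono power_increasing) auto
    also have "\<dots> = c * of_nat k ^ CARD('n)" by (simp add: c_def sum_distrib_right)
    also have "\<dots> \<le> of_nat C * of_nat k ^ CARD('n)" using C by (intro mult_right_mono) auto
    also have "\<dots> = (of_nat (C * k ^ CARD('n)) :: rat)" by simp
    finally show ?case by (simp only: of_nat_le_iff)
  qed
  then show thesis by (rule that)
qed

lemma card_atMost_const_vec: "card {..(\<chi> i. m) :: nat ^ 'n::finite} = Suc m ^ CARD('n)"
proof -
  have "bij_betw vec_nth {..(\<chi> i. m) :: nat ^ 'n} (\<Pi>\<^sub>E i\<in>UNIV. {..m})"
    by (rule bij_betwI[where g = vec_lambda]) (auto simp: less_eq_vec_def PiE_def Pi_def)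
  then show ?thesis by (simp add: bij_betw_same_card card_PiE)
qed

text \<open>
  With \<open>k = 2 n m\<close>, the \<open>(m + 1)\<^sup>2\<^sup>n\<close> monomials whose exponents are all at most \<open>m\<close> have total degree at
  most \<open>k\<close>. This gives \<open>(m + 1)\<^sup>2\<^sup>n (k + 1)\<close> unknowns against at most \<open>C\<^sup>2 k\<^sup>n (4 k)\<^sup>n = K m\<^sup>2\<^sup>n\<close>
  equations, where \<open>K\<close> does not depend on \<open>m\<close>.
\<close>

lemma exists_weyl_poly_in_ideal:
  fixes J :: "('n::finite, 'k::field_char_0) weyl set"
  assumes J: "left_ideal J" and Js: "\<And>P. P \<in> J \<Longrightarrow> P * s \<in> J"
    and s: "s \<in> bernstein_filtration 2"
    and growth: "\<forall>\<^sub>F k in sequentially. hilbert_fun J k \<le> C * k ^ CARD('n)"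
  obtains b where "b \<noteq> 0" "weyl_poly b s \<in> J"
proof -
  define n where "n = CARD('n)"
  have n: "n > 0" by (simp add: n_def)
  obtain k0 where k0: "\<And>k. k \<ge> k0 \<Longrightarrow> hilbert_fun J k \<le> C * k ^ n"
    using growth unfolding eventually_sequentially n_def by blast
  define K where "K = C ^ 2 * (16 * n ^ 2) ^ n"
  define m where "m = k0 + K"
  define k where "k = 2 * n * m"
  have km: "m \<le> k" unfolding k_def using n by (cases n) auto
  let ?v = "{..(\<chi> i. m) :: nat ^ 'n}"
  have "hilbert_fun J k * hilbert_fun J (4 * k) \<le> (C * k ^ n) * (C * (4 * k) ^ n)"
    using km by (intro mult_mono k0) (auto simp: m_def)
  also have "\<dots> = C ^ 2 * (k * (4 * k)) ^ n" by (simp add: power_mult_distrib power2_eq_square)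
  also have "k * (4 * k) = (16 * n ^ 2) * m ^ 2" by (simp add: k_def power2_eq_square)
  also have "C ^ 2 * ((16 * n ^ 2) * m ^ 2) ^ n = K * (m ^ n) ^ 2"
    by (simp add: K_def power_mult_distrib power_mult[symmetric] mult.commute)
  also have "\<dots> \<le> k * (Suc m ^ n) ^ 2"
    using km by (intro mult_mono power_mono) (auto simp: m_def)
  also have "\<dots> < (Suc m ^ n) ^ 2 * Suc k" by simp
  also have "(Suc m ^ n) ^ 2 = card (?v \<times> ?v)"
    by (simp add: card_cartesian_product card_atMost_const_vec n_def power2_eq_square)
  finally have card: "hilbert_fun J k * hilbert_fun J (4 * k) < card (?v \<times> ?v) * Suc k" .
  have deg: "(\<Sum>i\<in>UNIV. \<alpha> $ i + \<beta> $ i) \<le> k" if "(\<alpha>, \<beta>) \<in> ?v \<times> ?v" for \<alpha> \<beta>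
  proof -
    have "(\<Sum>i\<in>UNIV. \<alpha> $ i + \<beta> $ i) \<le> (\<Sum>i\<in>(UNIV :: 'n set). m + m)"
      using that by (intro sum_mono add_mono) (auto simp: less_eq_vec_def)
    then show ?thesis by (simp add: k_def n_def algebra_simps)
  qed
  have fin: "finite (?v \<times> ?v)" by (simp add: finite_atMost_vec)
  obtain P where P: "\<And>j. P j \<in> bernstein_filtration k" "\<exists>j\<le>k. P j \<noteq> 0"
    "\<And>Q. Q \<in> bernstein_filtration k \<Longrightarrow> (\<Sum>j\<le>k. P j * Q * s ^ j) \<in> J"
    by (rule annihilating_family[OF J Js s fin deg card]) (assumption | rule that)+
  show thesis
  proof (rule ccontr)
    assume "\<not> thesis"
    with that have ex: "\<And>b. weyl_poly b s \<in> J \<Longrightarrow> b = 0" by blast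
    then have "\<forall>j\<le>k. P j = 0" using P(1,3) by (rule bernstein_faithful[OF J])
    then show False using P(2) by blast
  qed
qed

section \<open>The Euler operator\<close>

lemma euler_op_bernstein: "euler_op \<phi> w \<in> bernstein_filtration 2"
  for w :: "real ^ 'n::finite" and \<phi> :: "real \<Rightarrow> 'k::field"
proof -
  have "wX i * wD i \<in> (bernstein_filtration (Suc 0 + Suc 0) :: ('n, 'k) weyl set)" for i
    by (intro bernstein_times wX_bernstein wD_bernstein)
  then show ?thesis
    unfolding euler_op_def numeral_2_eq_2
    by (intro wmod.subspace_sum wmod.subspace_scale subspace_bernstein) simp
qed

lemma Vhom_euler_op: "Vhom w 0 (euler_op \<phi> w)"
  unfolding euler_op_def
proof (intro Vhom_sum Vhom_scale)
  fix i :: 'a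
  have "wX i * wD i = (wmono (axis i 1) (axis i 1) :: ('a, 'b) weyl)"
    by (simp add: wX_def wmono_times_wD)
  then show "Vhom w 0 (wX i * wD i :: ('a, 'b) weyl)"
    by (simp add: Vhom_def Vweight_def)
qed

lemma real_subfield_embedding_zero:
  assumes "real_subfield_embedding F \<phi>"
  shows "0 \<in> F" "\<phi> 0 = 0"
proof -
  have F: "1 \<in> F" "\<And>a b. a \<in> F \<Longrightarrow> b \<in> F \<Longrightarrow> a - b \<in> F"
    and \<phi>: "\<And>a b. a \<in> F \<Longrightarrow> b \<in> F \<Longrightarrow> \<phi> (a + b) = \<phi> a + \<phi> b"
    using assms by (auto simp: real_subfield_embedding_def)
  show 0: "0 \<in> F" using F(2)[OF F(1) F(1)] by simp
  then show "\<phi> 0 = 0" using \<phi>[of 0 0] by (metis add.right_neutral add_left_cancel)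
qed

lemma real_subfield_embedding_diff:
  assumes emb: "real_subfield_embedding F \<phi>" and "a \<in> F" "b \<in> F"
  shows "a - b \<in> F" "\<phi> (a - b) = \<phi> a - \<phi> b"
proof -
  show *: "a - b \<in> F" using assms by (auto simp: real_subfield_embedding_def)
  have "\<phi> ((a - b) + b) = \<phi> (a - b) + \<phi> b"
    using emb * assms(3) unfolding real_subfield_embedding_def by blast
  then show "\<phi> (a - b) = \<phi> a - \<phi> b" by simp
qed

lemma real_subfield_embedding_add:
  assumes emb: "real_subfield_embedding F \<phi>" and "a \<in> F" "b \<in> F"
  shows "a + b \<in> F" "\<phi> (a + b) = \<phi> a + \<phi> b"
proof -
  have "a - (0 - b) \<in> F"
    by (intro real_subfield_embedding_diff[OF emb] real_subfield_embedding_zero[OF emb] assms)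
  then show "a + b \<in> F" by simp
  show "\<phi> (a + b) = \<phi> a + \<phi> b" using assms by (auto simp: real_subfield_embedding_def)
qed

lemma real_subfield_embedding_mult_nat:
  assumes emb: "real_subfield_embedding F \<phi>" and "a \<in> F"
  shows "a * real k \<in> F \<and> \<phi> (a * real k) = \<phi> a * of_nat k"
  by (induction k)
    (use real_subfield_embedding_add[OF emb] real_subfield_embedding_zero[OF emb] assms(2)
      in \<open>auto simp: algebra_simps\<close>)

lemma real_subfield_embedding_sum:
  assumes emb: "real_subfield_embedding F \<phi>" and "\<And>x. x \<in> A \<Longrightarrow> f x \<in> F"
  shows "sum f A \<in> F \<and> \<phi> (sum f A) = (\<Sum>x\<in>A. \<phi> (f x))"
  using assms(2)
  by (induction A rule: infinite_finite_induct)
    (use real_subfield_embedding_add[OF emb] real_subfield_embedding_zero[OF emb] in auto)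

lemma embedding_Vweight:
  assumes emb: "real_subfield_embedding F \<phi>" and w: "\<And>i. w $ i \<in> F"
  shows "\<phi> (Vweight w (\<alpha>, \<beta> :: nat ^ 'a::finite)) = (\<Sum>i\<in>UNIV. \<phi> (w $ i) * (of_nat (\<beta> $ i) - of_nat (\<alpha> $ i)))"
proof -
  have F: "(\<Sum>i\<in>UNIV. w $ i * real (\<gamma> $ i)) \<in> F \<and>
      \<phi> (\<Sum>i\<in>UNIV. w $ i * real (\<gamma> $ i)) = (\<Sum>i\<in>UNIV. \<phi> (w $ i) * of_nat (\<gamma> $ i))" for \<gamma> :: "nat ^ 'a"
    using real_subfield_embedding_sum[OF emb, of UNIV "\<lambda>i. w $ i * real (\<gamma> $ i)"]
      real_subfield_embedding_mult_nat[OF emb w] by simp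
  have "Vweight w (\<alpha>, \<beta>) = (\<Sum>i\<in>UNIV. w $ i * real (\<beta> $ i)) - (\<Sum>i\<in>UNIV. w $ i * real (\<alpha> $ i))"
    by (simp add: Vweight_def)
  then show ?thesis
    using real_subfield_embedding_diff(2)[OF emb] F
    by (simp add: right_diff_distrib sum_subtractf)
qed

text \<open>
  Monomials are eigenvectors of the commutator with \<open>s\<close>; the eigenvalue is the image of the weight
  under \<open>\<phi>\<close> by \<open>embedding_Vweight\<close>.
\<close>

lemma wmono_times_euler_op:
  fixes \<alpha> \<beta> :: "nat ^ 'a::finite" and \<phi> :: "real \<Rightarrow> 'b::comm_ring_1"
  shows "wmono \<alpha> \<beta> * euler_op \<phi> w = euler_op \<phi> w * wmono \<alpha> \<beta> +
    wscale (\<Sum>i\<in>UNIV. \<phi> (w $ i) * (of_nat (\<beta> $ i) - of_nat (\<alpha> $ i))) (wmono \<alpha> \<beta>)"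
proof -
  have absorb: "wscale (of_nat (\<gamma> $ i)) (wmono' (axis i 1 + (\<gamma> - axis i 1))) = wscale (of_nat (\<gamma> $ i)) (wmono' \<gamma>)"
    for \<gamma> :: "nat ^ 'a" and i and wmono' :: "nat ^ 'a \<Rightarrow> ('a, 'b) weyl"
  proof (cases "\<gamma> $ i = 0")
    case False
    then have "axis i 1 + (\<gamma> - axis i 1) = \<gamma>" by (auto simp: vec_eq_iff axis_def)
    then show ?thesis by simp
  qed simp
  have 1: "(wX i * wD i) * wmono \<alpha> \<beta> =
      wmono (axis i 1 + \<alpha>) (axis i 1 + \<beta>) + wscale (of_nat (\<alpha> $ i)) (wmono \<alpha> \<beta> :: ('a, 'b) weyl)" for i
    by (simp add: mult.assoc wD_times_wmono distrib_left wX_times_wmono wscale_times_right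
        absorb[of \<alpha> i "\<lambda>\<gamma>. wmono \<gamma> \<beta>"] del: One_nat_def)
  have 2: "wmono \<alpha> \<beta> * (wX i * wD i) =
      wmono (axis i 1 + \<alpha>) (axis i 1 + \<beta>) + wscale (of_nat (\<beta> $ i)) (wmono \<alpha> \<beta> :: ('a, 'b) weyl)" for i
    by (simp add: mult.assoc[symmetric] wmono_times_wX distrib_right wmono_times_wD wscale_times_left
        absorb[of \<beta> i "wmono \<alpha>"] del: One_nat_def)
  show ?thesis
    unfolding euler_op_def sum_distrib_left sum_distrib_right wscale_times_left wscale_times_right
      1 2 wmod.scale_sum_left sum.distrib[symmetric]
    by (rule sum.cong) (auto simp: algebra_simps wmod.scale_left_diff_distrib wmod.scale_right_distrib)
qed

lemma Vhom_times_euler_op: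
  assumes emb: "real_subfield_embedding F \<phi>" and w: "\<And>i. w $ i \<in> F" and P: "Vhom w d P"
  shows "P * euler_op \<phi> w = euler_op \<phi> w * P + wscale (\<phi> d) P"
proof -
  let ?s = "euler_op \<phi> w"
  let ?m = "\<lambda>m. wscale (wcoeff P m) (wmono (fst m) (snd m))"
  have P_eq: "P = (\<Sum>m\<in>wsupp P. ?m m)" by (rule weyl_expand)
  have "?m m * ?s = ?s * ?m m + wscale (\<phi> d) (?m m)" if "m \<in> wsupp P" for m
  proof -
    have "\<phi> d = (\<Sum>i\<in>UNIV. \<phi> (w $ i) * (of_nat (snd m $ i) - of_nat (fst m $ i)))"
      using embedding_Vweight[OF emb w, of "fst m" "snd m"] P that by (simp add: Vhom_def)
    then show ?thesis
      by (simp add: wscale_times_left wscale_times_right wmono_times_euler_op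
          wmod.scale_right_distrib mult.commute)
  qed
  then have "(\<Sum>m\<in>wsupp P. ?m m) * ?s = ?s * (\<Sum>m\<in>wsupp P. ?m m) + wscale (\<phi> d) (\<Sum>m\<in>wsupp P. ?m m)"
    unfolding sum_distrib_left sum_distrib_right wmod.scale_sum_right sum.distrib[symmetric]
    by (intro sum.cong) auto
  then show ?thesis by (simp flip: P_eq)
qed

text \<open>
  Right multiplication by \<open>s\<close> differs from left multiplication by a scalar on each homogeneous
  generator of the graded ideal.
\<close>

lemma grV_times_euler_op:
  assumes I: "left_ideal I" and emb: "real_subfield_embedding F \<phi>" and w: "\<And>i. w $ i \<in> F"
    and P: "P \<in> grV w I"
  shows "P * euler_op \<phi> w \<in> grV w I"
  using P unfolding grV_def
proof (induction rule: wmod.span_induct_alt)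
  case (step c x y)
  then obtain Q where Q: "x = sigmaV w Q" by blast
  have "x \<in> grV w I" using step by (auto simp: grV_def intro: wmod.span_base)
  then have "euler_op \<phi> w * x + wscale (\<phi> (ordV w Q)) x \<in> grV w I"
    using left_ideal_grV[OF I, of w] wscale_eq_times[of _ x] unfolding left_ideal_def by metis
  moreover have "Vhom w (ordV w Q) x" by (simp add: Q sigmaV_eq Vhom_Vpart)
  ultimately have "x * euler_op \<phi> w \<in> wmod.span {sigmaV w P | P. P \<in> I \<and> P \<noteq> 0}"
    using Vhom_times_euler_op[OF emb w, of "ordV w Q" x] by (simp add: grV_def)
  then show ?case
    using step by (auto simp: distrib_right wscale_times_left intro: wmod.span_add wmod.span_scale)
qed (simp add: wmod.span_zero)

section \<open>The intersection with the polynomials in the Euler operator\<close>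

theorem proposition2p19:
  fixes I :: "('n::finite, 'k::field_char_0) weyl set"
    and w :: "real ^ 'n"
    and F :: "real set" and \<phi> :: "real \<Rightarrow> 'k"
    and s q :: "('n, 'k) weyl"
  assumes "left_ideal I" and "holonomic I"
    and "w \<noteq> 0" and "\<And>i. w $ i \<ge> 0"
    and "real_subfield_embedding F \<phi>" and "\<And>i. w $ i \<in> F"
    and "s = euler_op \<phi> w"
    and "q \<in> subalgebra_gen s"
  shows "(grV w I + left_mults UNIV q) \<inter> subalgebra_gen s =
    (grV w I \<inter> subalgebra_gen s) + left_mults (subalgebra_gen s) q"
proof -
  note emb = assms(5) and wF = assms(6) and s = assms(7)
  define J where "J = grV w I"
  have J: "left_ideal J" unfolding J_def by (rule left_ideal_grV[OF assms(1)])
  have Jadd: "\<And>P Q. P \<in> J \<Longrightarrow> Q \<in> J \<Longrightarrow> P + Q \<in> J" and Jmult: "\<And>R P. P \<in> J \<Longrightarrow> R * P \<in> J"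
    using J by (auto simp: left_ideal_def)
  have Js: "P * s \<in> J" if "P \<in> J" for P
    using grV_times_euler_op[OF assms(1) emb wF] that by (simp add: J_def s)
  have homp: "Vhom w 0 (weyl_poly p s)" for p
    unfolding weyl_poly_def s by (intro Vhom_sum Vhom_scale Vhom_power Vhom_euler_op)
  obtain q0 where q0: "q = weyl_poly q0 s" using assms(8) by (auto simp: subalgebra_gen_def)
  obtain C where "\<forall>\<^sub>F k in sequentially. hilbert_fun I k \<le> C * k ^ CARD('n)"
    using holonomic_growth[OF assms(2)] by blast
  then have "\<forall>\<^sub>F k in sequentially. hilbert_fun J k \<le> C * k ^ CARD('n)"
    by eventually_elim (use hilbert_fun_grV_le[OF assms(1), of w] in \<open>auto simp: J_def intro: order_trans\<close>)
  then obtain b0 where b0: "b0 \<noteq> 0" "weyl_poly b0 s \<in> J"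
    using exists_weyl_poly_in_ideal[OF J Js] euler_op_bernstein[of \<phi> w] unfolding s by blast
  obtain b where b: "weyl_poly b s \<in> J" "b \<noteq> 0" and b_dvd: "\<And>p. weyl_poly p s \<in> J \<Longrightarrow> b dvd p"
    using poly_ideal_principal[of b0 "{p. weyl_poly p s \<in> J}"] b0 Jadd Jmult
    by (auto simp: weyl_poly_add weyl_poly_mult)
  \<comment> \<open>\<open>A\<close> is the ideal \<open>(b, q0)\<close>; its generator \<open>g\<close> is a greatest common divisor of \<open>b\<close> and \<open>q0\<close>\<close>
  define A where "A = {u * b + v * q0 | u v. True}"
  have inA: "b \<in> A" "q0 \<in> A"
    unfolding A_def by (force intro: exI[of _ 1] exI[of _ 0])+
  have "p + p' \<in> A" if pA: "p \<in> A" "p' \<in> A" for p p'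
  proof -
    obtain u v u' v' where "p = u * b + v * q0" "p' = u' * b + v' * q0" using pA by (auto simp: A_def)
    then have "p + p' = (u + u') * b + (v + v') * q0" by (simp add: algebra_simps)
    then show ?thesis unfolding A_def by blast
  qed
  moreover have "r * p \<in> A" if pA: "p \<in> A" for r p
  proof -
    obtain u v where "p = u * b + v * q0" using pA by (auto simp: A_def)
    then have "r * p = (r * u) * b + (r * v) * q0" by (simp add: algebra_simps)
    then show ?thesis unfolding A_def by blast
  qed
  ultimately obtain g where g: "g \<in> A" "\<And>p. p \<in> A \<Longrightarrow> g dvd p"
    using poly_ideal_principal[of b A] inA b by metis
  obtain u v where guv: "g = u * b + v * q0" using g(1) by (auto simp: A_def)
  obtain b' q' where b': "b = g * b'" and q': "q0 = g * q'" using g(2) inA by (meson dvdE)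
  show ?thesis
  proof (intro equalityI subsetI)
    fix P assume P: "P \<in> (grV w I + left_mults UNIV q) \<inter> subalgebra_gen s"
    then obtain p where p: "P = weyl_poly p s" by (auto simp: subalgebra_gen_def)
    from P obtain j R where jR: "j \<in> J" "P = j + R * q"
      by (auto simp: J_def left_mults_def elim!: set_plus_elim)
    define j0 where "j0 = Vpart w 0 j"
    define R0 where "R0 = Vpart w 0 R"
    have "j0 \<in> J" unfolding j0_def J_def by (rule Vpart_grV) (use jR in \<open>simp add: J_def\<close>)
    have "P = Vpart w 0 P" using Vpart_Vhom[OF homp] by (simp add: p)
    also have "\<dots> = j0 + R0 * q"
      using Vpart_times_right[OF homp[of q0], of 0 R] by (simp add: jR Vpart_add j0_def R0_def q0)
    finally have P_eq: "P = j0 + R0 * q" .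
    \<comment> \<open>weight 0 makes the scalar \<open>\<phi> 0\<close> in the commutator with \<open>s\<close> vanish\<close>
    have "R0 * s = s * R0"
      using Vhom_times_euler_op[OF emb wF, of 0 R0] real_subfield_embedding_zero(2)[OF emb]
      by (simp add: R0_def Vhom_Vpart s)
    then have comm: "R0 * weyl_poly r s = weyl_poly r s * R0" for r by (rule weyl_poly_commute_with)
    have "weyl_poly b' s * (R0 * q) = R0 * weyl_poly (b' * q0) s"
      by (simp add: q0 comm) (simp add: weyl_poly_mult mult.assoc)
    also have "b' * q0 = q' * b" by (simp add: b' q')
    finally have "weyl_poly b' s * (R0 * q) \<in> J" using b Jmult by (simp add: weyl_poly_mult)
    moreover have "weyl_poly b' s * j0 \<in> J" using \<open>j0 \<in> J\<close> Jmult by blast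
    ultimately have "weyl_poly b' s * P \<in> J" unfolding P_eq distrib_left by (metis Jadd)
    then have "weyl_poly (b' * p) s \<in> J" by (simp add: p weyl_poly_mult)
    then have "b dvd b' * p" by (rule b_dvd)
    then have "g dvd p" using b b' by (simp add: mult.commute)
    then obtain r where "p = g * r" by (auto elim: dvdE)
    then have "p = (u * r) * b + (v * r) * q0" by (simp add: guv algebra_simps)
    then have "P = weyl_poly ((u * r) * b) s + weyl_poly (v * r) s * q"
      by (simp add: p q0 weyl_poly_add weyl_poly_mult)
    moreover have "weyl_poly ((u * r) * b) s \<in> grV w I \<inter> subalgebra_gen s"
      unfolding J_def[symmetric] subalgebra_gen_def using Jmult[OF b(1)] by (simp add: weyl_poly_mult[of "u * r"])
        (simp flip: weyl_poly_mult)
    moreover have "weyl_poly (v * r) s * q \<in> left_mults (subalgebra_gen s) q"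
      by (auto simp: left_mults_def subalgebra_gen_def)
    ultimately show "P \<in> (grV w I \<inter> subalgebra_gen s) + left_mults (subalgebra_gen s) q"
      using set_plus_intro by blast
  next
    fix P assume "P \<in> (grV w I \<inter> subalgebra_gen s) + left_mults (subalgebra_gen s) q"
    then obtain j r t where P: "P = j + weyl_poly r s * q" "j \<in> grV w I" "j = weyl_poly t s"
      by (auto simp: left_mults_def subalgebra_gen_def elim!: set_plus_elim)
    have "P = weyl_poly (t + r * q0) s" by (simp add: P(1,3) q0 weyl_poly_add weyl_poly_mult)
    then have "P \<in> subalgebra_gen s" by (auto simp: subalgebra_gen_def)
    moreover have "P \<in> grV w I + left_mults UNIV q"
      unfolding P(1) using P(2) by (intro set_plus_intro) (auto simp: left_mults_def)
    ultimately show "P \<in> (grV w I + left_mults UNIV q) \<inter> subalgebra_gen s" by blast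
  qed
qed

end
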